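(* Let $S$ be a finite $E$-Ehresmann semigroup whose corresponding Ehresmann category $C=\mathbf{C}(S)$ is an EI-category, and let $\mathbb{K}$ be a field such that the orders of the endomorphism groups of all objects of $C$ are invertible in $\mathbb{K}$. Then the semigroup algebra $\mathbb{K}\mathrm{Reg}_E(S)$ of the subsemigroup $\mathrm{Reg}_E(S)=\{a\in S\mid a^+\,\mathcal{R}\,a\,\mathcal{L}\,a^\ast\}$ of $S$ is isomorphic, as a $\mathbb{K}$-algebra, to $\mathbb{K}S/\mathrm{Rad}(\mathbb{K}S)$.
   Context: Let $S$ be a semigroup and $E\subseteq E(S)$ a subsemilattice (a subsemigroup of commuting idempotents). Define $a\,\widetilde{\mathcal{R}}_E\,b$ iff for all $e\in E$ ($ea=a\Leftrightarrow eb=b$), and $a\,\widetilde{\mathcal{L}}_E\,b$ iff for all $e\in E$ ($ae=a\Leftrightarrow be=b$). $S$ is $E$-Ehresmann if every $\widetilde{\mathcal{R}}_E$-class and every $\widetilde{\mathcal{L}}_E$-class contains precisely one element of $E$, $\widetilde{\mathcal{R}}_E$ is a left congruence and $\widetilde{\mathcal{L}}_E$ is a right congruence. The element of $E$ in the $\widetilde{\mathcal{R}}_E$-class (resp. $\widetilde{\mathcal{L}}_E$-class) of $a$ is denoted $a^+$ (resp. $a^\ast$). The category $\mathbf{C}(S)=C$: its object set is $E$; its morphisms are in bijection with $S$, the morphism corresponding to $a\in S$ being denoted $C(a)$, with domain $a^+$ and range $a^\ast$. Morphisms are composed from left to right: $C(a)\cdot C(b)$ is defined iff $a^\ast=b^+$,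 and then $C(a)\cdot C(b)=C(ab)$. The identity morphism at $e\in E$ is $C(e)$. $\mathcal{R},\mathcal{L}$ are Green's relations on $S$. An EI-category is a category in which every endomorphism is an isomorphism. It is known that $\mathrm{Reg}_E(S)$ is a subsemigroup of $S$. For a semigroup $T$, $\mathbb{K}T$ is the $\mathbb{K}$-vector space with basis $T$ and multiplication extending that of $T$ bilinearly; under the hypotheses $\mathbb{K}S$ is a unital algebra. $\mathrm{Rad}$ denotes the Jacobson radical. *)

theory Defs
  imports "HOL-Algebra.QuotRing" "HOL-Algebra.Module"
begin

section \<open>Small categories and EI-categories\<close>

text \<open>
  Composition is written from left to right: \<open>Comp C f g\<close> is \<open>f\<close> followed by \<open>g\<close>. It is
  a total function, but it is meaningful only for composable arrows, i.e. when
  \<open>Cod C f = Dom C g\<close>.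
\<close>

record ('o, 'm) category =
  Obj :: "'o set"
  Arr :: "'m set"
  Dom :: "'m \<Rightarrow> 'o"
  Cod :: "'m \<Rightarrow> 'o"
  Ident :: "'o \<Rightarrow> 'm"
  Comp :: "'m \<Rightarrow> 'm \<Rightarrow> 'm"

definition Hom :: "('o, 'm) category \<Rightarrow> 'o \<Rightarrow> 'o \<Rightarrow> 'm set" where
  "Hom C x y = {f \<in> Arr C. Dom C f = x \<and> Cod C f = y}"

definition End_monoid :: "('o, 'm) category \<Rightarrow> 'o \<Rightarrow> 'm monoid" where
  "End_monoid C x = \<lparr>carrier = Hom C x x, mult = Comp C, one = Ident C x\<rparr>"

definition isomorphism :: "('o, 'm) category \<Rightarrow> 'm \<Rightarrow> bool" where
  "isomorphism C f \<longleftrightarrow> f \<in> Arr C \<and>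
    (\<exists>g \<in> Hom C (Cod C f) (Dom C f).
       Comp C f g = Ident C (Dom C f) \<and> Comp C g f = Ident C (Cod C f))"

locale category =
  fixes C :: "('o, 'm) category"
  assumes Dom_in_Obj: "f \<in> Arr C \<Longrightarrow> Dom C f \<in> Obj C"
    and Cod_in_Obj: "f \<in> Arr C \<Longrightarrow> Cod C f \<in> Obj C"
    and Ident_in_Hom: "x \<in> Obj C \<Longrightarrow> Ident C x \<in> Hom C x x"
    and Comp_in_Hom: "f \<in> Hom C x y \<Longrightarrow> g \<in> Hom C y z \<Longrightarrow> Comp C f g \<in> Hom C x z"
    and Comp_assoc: "f \<in> Hom C w x \<Longrightarrow> g \<in> Hom C x y \<Longrightarrow> h \<in> Hom C y z \<Longrightarrow>
      Comp C (Comp C f g) h = Comp C f (Comp C g h)"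
    and Ident_left: "f \<in> Hom C x y \<Longrightarrow> Comp C (Ident C x) f = f"
    and Ident_right: "f \<in> Hom C x y \<Longrightarrow> Comp C f (Ident C y) = f"

locale EI_category = category +
  assumes endo_isomorphism: "f \<in> Hom C x x \<Longrightarrow> isomorphism C f"

lemma (in EI_category) group_End_monoid:
  assumes "x \<in> Obj C"
  shows "group (End_monoid C x)"
proof (rule groupI)
  fix f assume "f \<in> carrier (End_monoid C x)"
  then have f: "f \<in> Hom C x x" by (simp add: End_monoid_def)
  then have "Dom C f = x" "Cod C f = x" by (auto simp: Hom_def)
  then show "\<exists>g \<in> carrier (End_monoid C x). g \<otimes>\<^bsub>End_monoid C x\<^esub> f = \<one>\<^bsub>End_monoid C x\<^esub>"
    using endo_isomorphism[OF f] by (auto simp: isomorphism_def End_monoid_def)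
qed (use assms in \<open>auto simp: End_monoid_def intro: Ident_in_Hom Comp_in_Hom Comp_assoc Ident_left\<close>)


section \<open>Ehresmann semigroups\<close>

definition subsemilattice :: "'a::semigroup_mult set \<Rightarrow> bool" where
  "subsemilattice E \<longleftrightarrow>
    (\<forall>e\<in>E. e * e = e) \<and> (\<forall>e\<in>E. \<forall>f\<in>E. e * f \<in> E \<and> e * f = f * e)"

definition R_tilde :: "'a::semigroup_mult set \<Rightarrow> 'a \<Rightarrow> 'a \<Rightarrow> bool" where
  "R_tilde E a b \<longleftrightarrow> (\<forall>e\<in>E. e * a = a \<longleftrightarrow> e * b = b)"

definition L_tilde :: "'a::semigroup_mult set \<Rightarrow> 'a \<Rightarrow> 'a \<Rightarrow> bool" where
  "L_tilde E a b \<longleftrightarrow> (\<forall>e\<in>E. a * e = a \<longleftrightarrow> b * e = b)"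

text \<open>
  The semigroup is the whole type. \<open>R_tilde E\<close> and \<open>L_tilde E\<close> are equivalence relations
  by their very form, so the classes are those of the individual elements and only
  one-sided compatibility has to be required for the congruence conditions.
\<close>

locale Ehresmann_semigroup =
  fixes E :: "'a::semigroup_mult set"
  assumes subsemilattice: "subsemilattice E"
    and R_tilde_class: "\<exists>!e. e \<in> E \<and> R_tilde E a e"
    and L_tilde_class: "\<exists>!e. e \<in> E \<and> L_tilde E a e"
    and R_tilde_left_congruence: "R_tilde E a b \<Longrightarrow> R_tilde E (c * a) (c * b)"
    and L_tilde_right_congruence: "L_tilde E a b \<Longrightarrow> L_tilde E (a * c) (b * c)"

definition plus_proj :: "'a::semigroup_mult set \<Rightarrow> 'a \<Rightarrow> 'a" where
  "plus_proj E a = (THE e. e \<in> E \<and> R_tilde E a e)"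

definition star_proj :: "'a::semigroup_mult set \<Rightarrow> 'a \<Rightarrow> 'a" where
  "star_proj E a = (THE e. e \<in> E \<and> L_tilde E a e)"

text \<open>The morphism corresponding to an element of the semigroup is that element itself.\<close>

definition Ehresmann_category :: "'a::semigroup_mult set \<Rightarrow> ('a, 'a) category" where
  "Ehresmann_category E =
    \<lparr>Obj = E, Arr = UNIV, Dom = plus_proj E, Cod = star_proj E, Ident = (\<lambda>e. e), Comp = (*)\<rparr>"

text \<open>Green's relations: \<open>a S\<^sup>1 = b S\<^sup>1\<close> and \<open>S\<^sup>1 a = S\<^sup>1 b\<close>.\<close>

definition Green_R :: "'a::semigroup_mult \<Rightarrow> 'a \<Rightarrow> bool" where
  "Green_R a b \<longleftrightarrow> insert a (range (\<lambda>s. a * s)) = insert b (range (\<lambda>s. b * s))"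

definition Green_L :: "'a::semigroup_mult \<Rightarrow> 'a \<Rightarrow> bool" where
  "Green_L a b \<longleftrightarrow> insert a (range (\<lambda>s. s * a)) = insert b (range (\<lambda>s. s * b))"

definition Reg :: "'a::semigroup_mult set \<Rightarrow> 'a set" where
  "Reg E = {a. Green_R (plus_proj E a) a \<and> Green_L a (star_proj E a)}"

context Ehresmann_semigroup
begin

lemma plus_proj: "plus_proj E a \<in> E" "R_tilde E a (plus_proj E a)"
  unfolding plus_proj_def using theI'[OF R_tilde_class[of a]] by auto

lemma star_proj: "star_proj E a \<in> E" "L_tilde E a (star_proj E a)"
  unfolding star_proj_def using theI'[OF L_tilde_class[of a]] by auto

lemma plus_proj_eqI: "R_tilde E a b \<Longrightarrow> plus_proj E a = plus_proj E b"
  unfolding plus_proj_def R_tilde_def by simp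

lemma star_proj_eqI: "L_tilde E a b \<Longrightarrow> star_proj E a = star_proj E b"
  unfolding star_proj_def L_tilde_def by simp

lemma plus_proj_idem: "e \<in> E \<Longrightarrow> plus_proj E e = e"
  using R_tilde_class[of e] plus_proj[of e] unfolding R_tilde_def by blast

lemma star_proj_idem: "e \<in> E \<Longrightarrow> star_proj E e = e"
  using L_tilde_class[of e] star_proj[of e] unfolding L_tilde_def by blast

lemma plus_proj_mult: "plus_proj E a * a = a"
  using plus_proj[of a] subsemilattice unfolding R_tilde_def subsemilattice_def by blast

lemma mult_star_proj: "a * star_proj E a = a"
  using star_proj[of a] subsemilattice unfolding L_tilde_def subsemilattice_def by blast

lemma plus_proj_comp:
  assumes "star_proj E a = plus_proj E b"
  shows "plus_proj E (a * b) = plus_proj E a"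
  using plus_proj_eqI[OF R_tilde_left_congruence[OF plus_proj(2)[of b], of a]]
    mult_star_proj[of a] assms by simp

lemma star_proj_comp:
  assumes "star_proj E a = plus_proj E b"
  shows "star_proj E (a * b) = star_proj E b"
  using star_proj_eqI[OF L_tilde_right_congruence[OF star_proj(2)[of a], of b]]
    plus_proj_mult[of b] assms by simp

lemma category_Ehresmann_category: "category (Ehresmann_category E)"
  by unfold_locales
    (auto simp: Ehresmann_category_def Hom_def plus_proj star_proj plus_proj_idem star_proj_idem
      plus_proj_comp star_proj_comp plus_proj_mult mult_star_proj mult.assoc)

end


section \<open>Semigroup algebras\<close>

text \<open>
  The algebra of a subsemigroup \<open>T\<close>: finitely supported functions vanishing outside \<open>T\<close>,
  the basis element \<open>t\<close> being the indicator function of \<open>{t}\<close>, with the convolution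
  product. The algebra may be unital without \<open>T\<close> having an identity, hence the choice of
  the field \<open>one\<close>, which is meaningful only if a two-sided identity exists.
\<close>

definition conv :: "('a::semigroup_mult \<Rightarrow> 'k::field) \<Rightarrow> ('a \<Rightarrow> 'k) \<Rightarrow> 'a \<Rightarrow> 'k" where
  "conv f g = (\<lambda>x. \<Sum>(y, z) \<in> {(y, z). f y \<noteq> 0 \<and> g z \<noteq> 0 \<and> y * z = x}. f y * g z)"

definition fin_supp_on :: "'a set \<Rightarrow> ('a \<Rightarrow> 'k::field) set" where
  "fin_supp_on T = {f. finite {x. f x \<noteq> 0} \<and> {x. f x \<noteq> 0} \<subseteq> T}"

definition semigroup_algebra ::
  "'a::semigroup_mult set \<Rightarrow> ('k::field, 'a \<Rightarrow> 'k) module" where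
  "semigroup_algebra T =
    \<lparr>carrier = fin_supp_on T,
     mult = conv,
     one = (THE u. u \<in> fin_supp_on T \<and> (\<forall>f \<in> fin_supp_on T. conv u f = f \<and> conv f u = f)),
     zero = (\<lambda>x. 0),
     add = (\<lambda>f g x. f x + g x),
     smult = (\<lambda>c f x. c * f x)\<rparr>"


section \<open>Jacobson radical, quotient algebras and isomorphism of algebras\<close>

definition left_ideal :: "'b set \<Rightarrow> ('b, 'm) ring_scheme \<Rightarrow> bool" where
  "left_ideal I R \<longleftrightarrow>
    additive_subgroup I R \<and> (\<forall>r \<in> carrier R. \<forall>a \<in> I. r \<otimes>\<^bsub>R\<^esub> a \<in> I)"

definition maximal_left_ideal :: "'b set \<Rightarrow> ('b, 'm) ring_scheme \<Rightarrow> bool" where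
  "maximal_left_ideal I R \<longleftrightarrow>
    left_ideal I R \<and> I \<noteq> carrier R \<and>
    (\<forall>J. left_ideal J R \<longrightarrow> I \<subseteq> J \<longrightarrow> J = I \<or> J = carrier R)"

text \<open>This is the usual definition for rings with identity.\<close>

definition jacobson_radical :: "('b, 'm) ring_scheme \<Rightarrow> 'b set" where
  "jacobson_radical R = carrier R \<inter> \<Inter>{I. maximal_left_ideal I R}"

text \<open>
  The quotient ring \<open>A Quot I\<close> with the scalar multiplication \<open>c (I + x) = I + c x\<close>,
  written as a union over representatives in the style of \<^const>\<open>rcoset_mult\<close>.
\<close>

definition quotient_algebra :: "('k, 'b) module \<Rightarrow> 'b set \<Rightarrow> ('k, 'b set) module" where
  "quotient_algebra A I =
    ring.extend (A Quot I) (module.fields (\<lambda>c X. \<Union>x\<in>X. I +>\<^bsub>A\<^esub> (c \<odot>\<^bsub>A\<^esub> x)))"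

text \<open>The scalars range over the whole type \<open>'k\<close>, as in \<^const>\<open>semigroup_algebra\<close>.\<close>

definition algebra_iso :: "('k, 'b) module \<Rightarrow> ('k, 'c) module \<Rightarrow> ('b \<Rightarrow> 'c) set" where
  "algebra_iso A B =
    {h \<in> ring_iso A B. \<forall>c. \<forall>x \<in> carrier A. h (c \<odot>\<^bsub>A\<^esub> x) = c \<odot>\<^bsub>B\<^esub> h x}"

definition is_algebra_iso :: "('k, 'b) module \<Rightarrow> ('k, 'c) module \<Rightarrow> bool" where
  "is_algebra_iso A B \<longleftrightarrow> algebra_iso A B \<noteq> {}"

end

theory Submission
  imports Defs "HOL.Vector_Spaces" "HOL-Library.Function_Algebras"
begin

text \<open>
  \<open>Reg E\<close> is the set of isomorphisms of the Ehresmann category, hence a groupoid. Sending \<open>s\<close> to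
  the sum of all \<open>e s f\<close> (with \<open>e\<close>, \<open>f\<close> in \<open>E\<close>) that are isomorphisms from \<open>e\<close> to \<open>f\<close> is a
  homomorphism from \<open>KS\<close> to the groupoid algebra: if \<open>e s t g\<close> is an isomorphism, then by the EI
  condition it factors through exactly one object, \<open>(e s)\<^sup>* (t g)\<^sup>+\<close>. On \<open>K Reg E\<close> this map is
  unitriangular, hence bijective. Its kernel annihilates every simple module, and by Maschke's theorem
  the groupoid algebra has trivial radical, so the kernel is the radical of \<open>KS\<close>. Therefore
  \<open>K Reg E\<close> is a complement of the radical, and the isomorphism is the restriction of the quotient
  map.
\<close>

section \<open>Isomorphisms in the category of an Ehresmann semigroup\<close>

text \<open>Finiteness enters decisively through one fact: no object is isomorphic to an object
  strictly below it (\<open>isomorphic_le_eq\<close>). Both the uniqueness of the middle object and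
  the unitriangularity rest on it. The uniqueness argument compares isomorphisms with a common
  domain and says nothing about other arrows, which is why only the invertible restrictions of
  \<open>s\<close> are kept in the sum. The product of \<open>Reg E\<close> inside \<open>S\<close>
  is defined for all pairs and is not the groupoid product. The two are never matched directly:
  cosets of the radical are fibres of the map to the groupoid algebra, and each fibre contains
  exactly one element supported on \<open>Reg E\<close>.\<close>

lemma Green_R_iff:
  fixes a b :: "'a::semigroup_mult"
  shows "Green_R a b \<longleftrightarrow> a = b \<or> (\<exists>s t. a * s = b \<and> b * t = a)"
proof
  assume "Green_R a b"
  then have "a \<in> insert b (range ((*) b))" "b \<in> insert a (range ((*) a))"
    unfolding Green_R_def by blast+
  then show "a = b \<or> (\<exists>s t. a * s = b \<and> b * t = a)" by (metis imageE insertE)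
next
  have *: "insert (a * s) (range ((*) (a * s))) \<subseteq> insert a (range ((*) a))" for a s :: 'a
    by (auto simp: mult.assoc)
  assume "a = b \<or> (\<exists>s t. a * s = b \<and> b * t = a)"
  then show "Green_R a b"
    unfolding Green_R_def using *[of a] *[of b] by (metis subset_antisym)
qed

lemma Green_L_iff:
  fixes a b :: "'a::semigroup_mult"
  shows "Green_L a b \<longleftrightarrow> a = b \<or> (\<exists>s t. s * a = b \<and> t * b = a)"
proof
  assume "Green_L a b"
  then have "a \<in> insert b (range (\<lambda>s. s * b))" "b \<in> insert a (range (\<lambda>s. s * a))"
    unfolding Green_L_def by blast+
  then show "a = b \<or> (\<exists>s t. s * a = b \<and> t * b = a)" by (metis imageE insertE)
next
  have *: "insert (s * a) (range (\<lambda>t. t * (s * a))) \<subseteq> insert a (range (\<lambda>t. t * a))" for a s :: 'a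
    by (auto simp flip: mult.assoc)
  assume "a = b \<or> (\<exists>s t. s * a = b \<and> t * b = a)"
  then show "Green_L a b"
    unfolding Green_L_def using *[of _ a] *[of _ b] by (metis subset_antisym)
qed

context Ehresmann_semigroup
begin

abbreviation dom_proj :: "'a \<Rightarrow> 'a" (\<open>(_\<^sup>\<oplus>)\<close> [1000] 1000) where
  "a\<^sup>\<oplus> \<equiv> plus_proj E a"

abbreviation ran_proj :: "'a \<Rightarrow> 'a" (\<open>(_\<^sup>\<star>)\<close> [1000] 1000) where
  "a\<^sup>\<star> \<equiv> star_proj E a"

lemma E_closed: "e \<in> E \<Longrightarrow> f \<in> E \<Longrightarrow> e * f \<in> E"
  and E_commute: "e \<in> E \<Longrightarrow> f \<in> E \<Longrightarrow> e * f = f * e"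
  and E_idem: "e \<in> E \<Longrightarrow> e * e = e"
  using subsemilattice unfolding subsemilattice_def by auto

lemmas proj_in_E = plus_proj(1) star_proj(1)

text \<open>The order of the semilattice is always spelled out as an equation:
  \<open>e * f = f\<close> means that \<open>f\<close> lies below \<open>e\<close>. In these terms
  the domain is the least left identity from \<open>E\<close>.\<close>

lemma plus_proj_absorb: "e \<in> E \<Longrightarrow> e * a = a \<longleftrightarrow> e * a\<^sup>\<oplus> = a\<^sup>\<oplus>"
  using plus_proj(2)[of a] unfolding R_tilde_def by blast

lemma star_proj_absorb: "e \<in> E \<Longrightarrow> a * e = a \<longleftrightarrow> a\<^sup>\<star> * e = a\<^sup>\<star>"
  using star_proj(2)[of a] unfolding L_tilde_def by blast

lemma plus_proj_mult_plus: "(a * b)\<^sup>\<oplus> = (a * b\<^sup>\<oplus>)\<^sup>\<oplus>"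
  using plus_proj_eqI[OF R_tilde_left_congruence[OF plus_proj(2)[of b], of a]] .

lemma star_proj_star_mult: "(a * b)\<^sup>\<star> = (a\<^sup>\<star> * b)\<^sup>\<star>"
  using star_proj_eqI[OF L_tilde_right_congruence[OF star_proj(2)[of a], of b]] .

lemma plus_proj_E_mult: "e \<in> E \<Longrightarrow> (e * a)\<^sup>\<oplus> = e * a\<^sup>\<oplus>"
  using plus_proj_mult_plus[of e a] by (simp add: plus_proj_idem E_closed proj_in_E)

lemma star_proj_mult_E: "e \<in> E \<Longrightarrow> (a * e)\<^sup>\<star> = a\<^sup>\<star> * e"
  using star_proj_star_mult[of a e] by (simp add: star_proj_idem E_closed proj_in_E)

lemma plus_proj_mult_le: "a\<^sup>\<oplus> * (a * b)\<^sup>\<oplus> = (a * b)\<^sup>\<oplus>"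
  using plus_proj_absorb[of "a\<^sup>\<oplus>" "a * b"] by (simp add: proj_in_E plus_proj_mult flip: mult.assoc)

lemma star_proj_mult_le: "(a * b)\<^sup>\<star> * b\<^sup>\<star> = (a * b)\<^sup>\<star>"
  using star_proj_absorb[of "b\<^sup>\<star>" "a * b"] by (simp add: proj_in_E mult_star_proj mult.assoc)

text \<open>Mutually inverse arrows of the category. Since \<open>*\<close> is total, the last two
  conditions are what makes both composites meaningful.\<close>

definition inverse_arrows :: "'a \<Rightarrow> 'a \<Rightarrow> bool" where
  "inverse_arrows a b \<longleftrightarrow> a * b = a\<^sup>\<oplus> \<and> b * a = a\<^sup>\<star> \<and> b\<^sup>\<oplus> = a\<^sup>\<star> \<and> b\<^sup>\<star> = a\<^sup>\<oplus>"

lemma inverse_arrows_sym: "inverse_arrows a b \<Longrightarrow> inverse_arrows b a"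
  unfolding inverse_arrows_def by auto

lemma Reg_iff: "a \<in> Reg E \<longleftrightarrow> (\<exists>b. inverse_arrows a b)"
proof
  assume "a \<in> Reg E"
  then have R: "Green_R a\<^sup>\<oplus> a" and L: "Green_L a a\<^sup>\<star>" by (auto simp: Reg_def)
  have p: "a\<^sup>\<oplus> * a = a" and q: "a * a\<^sup>\<star> = a" by (rule plus_proj_mult, rule mult_star_proj)
  have i: "a\<^sup>\<oplus> * a\<^sup>\<oplus> = a\<^sup>\<oplus>" "a\<^sup>\<star> * a\<^sup>\<star> = a\<^sup>\<star>" by (auto intro: E_idem proj_in_E)
  obtain x where x: "a * x = a\<^sup>\<oplus>" using R i(1) unfolding Green_R_iff by metis
  obtain y where y: "y * a = a\<^sup>\<star>" using L i(2) unfolding Green_L_iff by metis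
  \<comment> \<open>Cutting the right inverse \<open>x\<close> down by the projections yields an
    arrow in the opposite direction. Cutting down the left inverse \<open>y\<close> gives the same
    element, because both equal \<open>y * a * x\<close>.\<close>
  define b where "b = a\<^sup>\<star> * x * a\<^sup>\<oplus>"
  have ab: "a * b = a\<^sup>\<oplus>" unfolding b_def using x q i by (metis mult.assoc)
  have "b = a\<^sup>\<star> * y * a\<^sup>\<oplus>" unfolding b_def using x y i by (metis mult.assoc)
  then have ba: "b * a = a\<^sup>\<star>" using y p i by (metis mult.assoc)
  have pb: "a\<^sup>\<star> * b = b" "b * a\<^sup>\<oplus> = b" unfolding b_def using i by (metis mult.assoc)+
  have "b\<^sup>\<oplus> = a\<^sup>\<star>"
  proof -
    have "b\<^sup>\<oplus> * a\<^sup>\<star> = a\<^sup>\<star>" using plus_proj_mult_le[of b a] ba by (simp add: plus_proj_idem proj_in_E)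
    moreover have "a\<^sup>\<star> * b\<^sup>\<oplus> = b\<^sup>\<oplus>" using pb plus_proj_absorb proj_in_E by blast
    ultimately show ?thesis using E_commute proj_in_E by metis
  qed
  moreover have "b\<^sup>\<star> = a\<^sup>\<oplus>"
  proof -
    have "a\<^sup>\<oplus> * b\<^sup>\<star> = a\<^sup>\<oplus>" using star_proj_mult_le[of a b] ab by (simp add: star_proj_idem proj_in_E)
    moreover have "b\<^sup>\<star> * a\<^sup>\<oplus> = b\<^sup>\<star>" using pb star_proj_absorb proj_in_E by blast
    ultimately show ?thesis using E_commute proj_in_E by metis
  qed
  ultimately show "\<exists>b. inverse_arrows a b" using ab ba unfolding inverse_arrows_def by blast
next
  assume "\<exists>b. inverse_arrows a b"
  then obtain b where "a * b = a\<^sup>\<oplus>" "b * a = a\<^sup>\<star>" unfolding inverse_arrows_def by auto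
  then show "a \<in> Reg E"
    unfolding Reg_def Green_R_iff Green_L_iff using plus_proj_mult mult_star_proj by blast
qed

lemma E_subset_Reg: "E \<subseteq> Reg E"
proof
  fix e assume "e \<in> E"
  then have "inverse_arrows e e" by (simp add: inverse_arrows_def plus_proj_idem star_proj_idem E_idem)
  then show "e \<in> Reg E" using Reg_iff by blast
qed

end

text \<open>The EI condition in the language of the semigroup: by \<open>Reg_iff\<close>, membership
  in \<open>Reg E\<close> is invertibility in the category.\<close>

locale finite_EI_Ehresmann_semigroup = Ehresmann_semigroup E
  for E :: "'a::{semigroup_mult, finite} set" +
  assumes EI: "a\<^sup>\<oplus> = a\<^sup>\<star> \<Longrightarrow> a \<in> Reg E"
begin

text \<open>In an EI-category a one-sided inverse is two-sided: \<open>v * u\<close> is an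
  idempotent endomorphism, hence invertible, hence an identity.\<close>

lemma section_iso:
  assumes uv: "u * v = u\<^sup>\<oplus>" and mid: "u\<^sup>\<star> = v\<^sup>\<oplus>" and ends: "v\<^sup>\<star> = u\<^sup>\<oplus>"
  shows "inverse_arrows u v"
proof -
  have "(v * u)\<^sup>\<oplus> = v\<^sup>\<oplus>" "(v * u)\<^sup>\<star> = u\<^sup>\<star>" using plus_proj_comp star_proj_comp ends by auto
  then obtain w where w: "v * u * w = v\<^sup>\<oplus>"
    using EI[of "v * u"] mid unfolding Reg_iff inverse_arrows_def by auto
  have idem: "v * u * (v * u) = v * u" using uv plus_proj_mult[of u] by (metis mult.assoc)
  have "v * u = v * u * (v * u * w)" unfolding w using mid mult_star_proj[of u] by (simp add: mult.assoc)
  also have "\<dots> = v\<^sup>\<oplus>" using idem w by (metis mult.assoc)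
  finally show ?thesis using assms unfolding inverse_arrows_def by auto
qed

text \<open>Following \<open>a\<close> by an inverse of \<open>b\<close> gives an endomorphism. It
  is invertible, so \<open>a\<close> has a right inverse, and \<open>section_iso\<close> does the
  rest.\<close>

lemma parallel_to_iso:
  assumes "b \<in> Reg E" "a\<^sup>\<oplus> = b\<^sup>\<oplus>" "a\<^sup>\<star> = b\<^sup>\<star>"
  shows "a \<in> Reg E"
proof -
  obtain c where c: "c\<^sup>\<oplus> = b\<^sup>\<star>" "c\<^sup>\<star> = b\<^sup>\<oplus>" using assms(1) unfolding Reg_iff inverse_arrows_def by auto
  have ac: "(a * c)\<^sup>\<oplus> = a\<^sup>\<oplus>" "(a * c)\<^sup>\<star> = a\<^sup>\<oplus>" using plus_proj_comp star_proj_comp c assms by auto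
  then obtain w where w: "a * c * w = a\<^sup>\<oplus>" "w\<^sup>\<oplus> = a\<^sup>\<oplus>" "w\<^sup>\<star> = a\<^sup>\<oplus>"
    using EI[of "a * c"] unfolding Reg_iff inverse_arrows_def by auto
  have "(c * w)\<^sup>\<oplus> = c\<^sup>\<oplus>" "(c * w)\<^sup>\<star> = w\<^sup>\<star>"
    using plus_proj_comp[of c w] star_proj_comp[of c w] c w(2) assms(2) by simp_all
  moreover have "a * (c * w) = a\<^sup>\<oplus>" using w(1) by (simp add: mult.assoc)
  ultimately have "inverse_arrows a (c * w)" using w(3) c(1) assms(3) by (intro section_iso) simp_all
  then show ?thesis unfolding Reg_iff by blast
qed

text \<open>Because the range lies below the domain, left multiplication by \<open>v\<close> maps
  the right ideal of all \<open>s\<close> fixed by the domain of \<open>u\<close> into itself. It is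
  injective, as \<open>u\<close> undoes it, so by finiteness it is surjective. That it hits the
  domain of \<open>u\<close> gives the reverse comparison.\<close>

lemma isomorphic_le_eq:
  assumes "inverse_arrows u v" and le: "u\<^sup>\<oplus> * u\<^sup>\<star> = u\<^sup>\<star>"
  shows "u\<^sup>\<oplus> = u\<^sup>\<star>"
proof -
  have uv: "u * v = u\<^sup>\<oplus>" and v: "u\<^sup>\<star> * v = v"
    using assms(1) plus_proj_mult[of v] unfolding inverse_arrows_def by auto
  let ?A = "{s. u\<^sup>\<oplus> * s = s}"
  have "u\<^sup>\<oplus> * v = u\<^sup>\<oplus> * u\<^sup>\<star> * v" using v by (simp add: mult.assoc)
  then have "u\<^sup>\<oplus> * v = v" using le v by simp
  then have "(*) v ` ?A \<subseteq> ?A" by (auto simp flip: mult.assoc)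
  moreover have "inj_on ((*) v) ?A"
  proof (rule inj_onI)
    fix x y assume "x \<in> ?A" "y \<in> ?A" "v * x = v * y"
    then have "u * v * x = u * v * y" by (simp add: mult.assoc)
    then show "x = y" using \<open>x \<in> ?A\<close> \<open>y \<in> ?A\<close> unfolding uv by simp
  qed
  ultimately have "(*) v ` ?A = ?A" by (intro endo_inj_surj) auto
  moreover have "u\<^sup>\<oplus> \<in> ?A" by (simp add: E_idem proj_in_E)
  ultimately have "u\<^sup>\<oplus> \<in> (*) v ` ?A" by (simp only:)
  then obtain s where "u\<^sup>\<oplus> = v * s" by (rule imageE)
  then have "u\<^sup>\<star> * u\<^sup>\<oplus> = u\<^sup>\<oplus>" using v by (simp flip: mult.assoc)
  then show ?thesis using le E_commute[OF proj_in_E(2)[of u] proj_in_E(1)[of u]] by simp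
qed

text \<open>The composite of an inverse of \<open>a\<close> with \<open>b\<close> is an isomorphism
  between the two ranges, so \<open>isomorphic_le_eq\<close> applies.\<close>

lemma Reg_same_dom_le:
  assumes "a \<in> Reg E" "b \<in> Reg E" "a\<^sup>\<oplus> = b\<^sup>\<oplus>" "a\<^sup>\<star> * b\<^sup>\<star> = b\<^sup>\<star>"
  shows "a\<^sup>\<star> = b\<^sup>\<star>"
proof -
  obtain a' b' where a': "inverse_arrows a a'" and b': "inverse_arrows b b'"
    using assms unfolding Reg_iff by auto
  have m: "a'\<^sup>\<star> = b\<^sup>\<oplus>" "b'\<^sup>\<star> = a\<^sup>\<oplus>" using a' b' assms unfolding inverse_arrows_def by auto
  have "a' * b * (b' * a) = a' * (b * b') * a" by (simp add: mult.assoc)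
  also have "b * b' = a'\<^sup>\<star>" using a' b' assms unfolding inverse_arrows_def by auto
  also have "a' * \<dots> * a = a\<^sup>\<star>" using a' mult_star_proj[of a'] unfolding inverse_arrows_def by auto
  finally have "inverse_arrows (a' * b) (b' * a)"
    using m a' b' assms plus_proj_comp star_proj_comp
    by (intro section_iso) (auto simp: inverse_arrows_def)
  moreover have "(a' * b)\<^sup>\<oplus> = a\<^sup>\<star>" "(a' * b)\<^sup>\<star> = b\<^sup>\<star>"
    using m a' plus_proj_comp star_proj_comp by (auto simp: inverse_arrows_def)
  ultimately show ?thesis using isomorphic_le_eq[of "a' * b"] assms by auto
qed

text \<open>Existence of the middle object. The range of \<open>b\<^sup>\<oplus> * s\<close> and the
  domain of \<open>t * b\<^sup>\<star>\<close> can be inserted between \<open>s\<close> and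
  \<open>t\<close> without changing the product, hence so can their meet \<open>k\<close>. Then
  \<open>c\<close> and \<open>d\<close> are composable at \<open>k\<close>. An inverse of
  \<open>b\<close> provides a right inverse of \<open>c\<close> and a left inverse of
  \<open>d\<close>, and one side is enough by \<open>section_iso\<close>.\<close>

lemma Reg_factor:
  assumes b: "b \<in> Reg E" and st: "b\<^sup>\<oplus> * s * t * b\<^sup>\<star> = b"
  defines "k \<equiv> (b\<^sup>\<oplus> * s)\<^sup>\<star> * (t * b\<^sup>\<star>)\<^sup>\<oplus>"
  defines "c \<equiv> b\<^sup>\<oplus> * s * k" and "d \<equiv> k * t * b\<^sup>\<star>"
  shows "c \<in> Reg E" "d \<in> Reg E" "c\<^sup>\<oplus> = b\<^sup>\<oplus>" "c\<^sup>\<star> = k" "d\<^sup>\<oplus> = k" "d\<^sup>\<star> = b\<^sup>\<star>" "c * d = b"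
proof -
  have kE: "k \<in> E" unfolding k_def by (intro E_closed proj_in_E)
  have kk: "k * k = k" using kE by (rule E_idem)
  have "b = b\<^sup>\<oplus> * s * (t * b\<^sup>\<star>)" using st by (simp add: mult.assoc)
  also have "\<dots> = (b\<^sup>\<oplus> * s) * (b\<^sup>\<oplus> * s)\<^sup>\<star> * ((t * b\<^sup>\<star>)\<^sup>\<oplus> * (t * b\<^sup>\<star>))"
    by (simp only: mult_star_proj plus_proj_mult)
  also have "\<dots> = b\<^sup>\<oplus> * s * k * (t * b\<^sup>\<star>)" unfolding k_def by (simp add: mult.assoc)
  also have "\<dots> = b\<^sup>\<oplus> * s * (k * k) * (t * b\<^sup>\<star>)" using kk by simp
  also have "\<dots> = c * d" unfolding c_def d_def by (simp add: mult.assoc)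
  finally show cd: "c * d = b" by simp
  show cs: "c\<^sup>\<star> = k" unfolding c_def star_proj_mult_E[OF kE] unfolding k_def
    using E_idem[OF proj_in_E(2)] by (simp flip: mult.assoc)
  have "d\<^sup>\<oplus> = k * (t * b\<^sup>\<star>)\<^sup>\<oplus>" unfolding d_def using plus_proj_E_mult[OF kE] by (simp add: mult.assoc)
  then show dp: "d\<^sup>\<oplus> = k" unfolding k_def using E_idem[OF proj_in_E(1)] by (simp add: mult.assoc)
  show "c\<^sup>\<oplus> = b\<^sup>\<oplus>" using plus_proj_comp[of c d] cd cs dp by simp
  show "d\<^sup>\<star> = b\<^sup>\<star>" using star_proj_comp[of c d] cd cs dp by simp
  obtain b' where b': "inverse_arrows b b'" using b Reg_iff by auto
  have "inverse_arrows c (d * b')"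
  proof (rule section_iso)
    show "c * (d * b') = c\<^sup>\<oplus>" using cd b' \<open>c\<^sup>\<oplus> = b\<^sup>\<oplus>\<close> unfolding inverse_arrows_def by (metis mult.assoc)
    show "c\<^sup>\<star> = (d * b')\<^sup>\<oplus>" using cs dp \<open>d\<^sup>\<star> = b\<^sup>\<star>\<close> b' plus_proj_comp[of d b'] unfolding inverse_arrows_def by auto
    show "(d * b')\<^sup>\<star> = c\<^sup>\<oplus>" using \<open>c\<^sup>\<oplus> = b\<^sup>\<oplus>\<close> \<open>d\<^sup>\<star> = b\<^sup>\<star>\<close> b' star_proj_comp[of d b'] unfolding inverse_arrows_def by auto
  qed
  then show "c \<in> Reg E" using Reg_iff by blast
  have "inverse_arrows (b' * c) d"
  proof (rule section_iso)
    have m: "b'\<^sup>\<star> = c\<^sup>\<oplus>" using b' \<open>c\<^sup>\<oplus> = b\<^sup>\<oplus>\<close> unfolding inverse_arrows_def by auto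
    show "b' * c * d = (b' * c)\<^sup>\<oplus>" using m cd b' plus_proj_comp[of b' c] unfolding inverse_arrows_def by (auto simp: mult.assoc)
    show "(b' * c)\<^sup>\<star> = d\<^sup>\<oplus>" using m cs dp star_proj_comp[of b' c] by auto
    show "d\<^sup>\<star> = (b' * c)\<^sup>\<oplus>" using m \<open>d\<^sup>\<star> = b\<^sup>\<star>\<close> b' plus_proj_comp[of b' c] unfolding inverse_arrows_def by auto
  qed
  then show "d \<in> Reg E" using Reg_iff inverse_arrows_sym by blast
qed

text \<open>Uniqueness of the middle object: if restrictions of \<open>s\<close> and
  \<open>t\<close> compose at \<open>f\<close>, then \<open>f\<close> lies below the
  \<open>k\<close> of \<open>Reg_factor\<close>. The product \<open>e * s * t * g\<close> is
  parallel to the isomorphism \<open>c * d\<close>, hence itself one, and factors through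
  \<open>k\<close>. Now \<open>e\<close> has isomorphisms to both \<open>k\<close> and
  \<open>f\<close>, which are comparable, so they coincide.\<close>

lemma Reg_factor_unique:
  assumes c: "c \<in> Reg E" and d: "d \<in> Reg E" and cd: "c\<^sup>\<star> = d\<^sup>\<oplus>"
    and s: "c\<^sup>\<oplus> * s * c\<^sup>\<star> = c" and t: "d\<^sup>\<oplus> * t * d\<^sup>\<star> = d"
  shows "c\<^sup>\<oplus> * s * t * d\<^sup>\<star> = c * d" "c\<^sup>\<star> = (c\<^sup>\<oplus> * s)\<^sup>\<star> * (t * d\<^sup>\<star>)\<^sup>\<oplus>"
proof -
  define e f g where "e = c\<^sup>\<oplus>" and "f = c\<^sup>\<star>" and "g = d\<^sup>\<star>"
  have E: "e \<in> E" "f \<in> E" "g \<in> E" unfolding e_def f_def g_def by (auto intro: proj_in_E)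
  define b k where "b = e * s * t * g" and "k = (e * s)\<^sup>\<star> * (t * g)\<^sup>\<oplus>"
  have kE: "k \<in> E" unfolding k_def by (intro E_closed proj_in_E)
  have f1: "(e * s)\<^sup>\<star> * f = f" using star_proj_mult_E[OF E(2), of "e * s"] s unfolding e_def f_def by simp
  have f2: "f * (t * g)\<^sup>\<oplus> = f" using plus_proj_E_mult[OF E(2), of "t * g"] t cd unfolding f_def g_def
    by (simp add: mult.assoc)
  have f1': "f * (e * s)\<^sup>\<star> = f" and f2': "(t * g)\<^sup>\<oplus> * f = f"
    using f1 f2 E_commute[OF E(2) proj_in_E(2)] E_commute[OF E(2) proj_in_E(1)] by simp_all
  have kf: "k * f = f" unfolding k_def using f1 f2' by (simp add: mult.assoc)
  have cf: "c = e * s * f" "d = f * t * g" using s t cd unfolding e_def f_def g_def by auto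
  \<comment> \<open>Only \<open>e\<close> below the domain of \<open>b\<close> is not immediate.
    That domain does not change when \<open>t * g\<close> is replaced by its own domain. Multiplying
    the result by \<open>f\<close> gives \<open>c\<close>, and a product has its domain below that
    of its first factor.\<close>
  have bp: "b\<^sup>\<oplus> = e"
  proof -
    have "b\<^sup>\<oplus> = (e * s * (t * g)\<^sup>\<oplus>)\<^sup>\<oplus>" unfolding b_def using plus_proj_mult_plus[of "e * s" "t * g"] by (simp add: mult.assoc)
    moreover have "e * s * (t * g)\<^sup>\<oplus> * f = c" using f2' cf by (simp add: mult.assoc)
    ultimately have "b\<^sup>\<oplus> * e = e" using plus_proj_mult_le[of "e * s * (t * g)\<^sup>\<oplus>" f] by (simp add: e_def)
    moreover have "e * b\<^sup>\<oplus> = b\<^sup>\<oplus>"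
      using plus_proj_absorb[OF E(1), of b] E_idem[OF E(1)] unfolding b_def by (simp flip: mult.assoc)
    moreover have "b\<^sup>\<oplus> * e = e * b\<^sup>\<oplus>" using E_commute E proj_in_E by simp
    ultimately show ?thesis by simp
  qed
  have bs: "b\<^sup>\<star> = g"
  proof -
    have "b\<^sup>\<star> = ((e * s)\<^sup>\<star> * (t * g))\<^sup>\<star>" unfolding b_def using star_proj_star_mult[of "e * s" "t * g"] by (simp add: mult.assoc)
    moreover have "f * ((e * s)\<^sup>\<star> * (t * g)) = d" using f1' cf by (simp flip: mult.assoc)
    ultimately have "g * b\<^sup>\<star> = g" using star_proj_mult_le[of f "(e * s)\<^sup>\<star> * (t * g)"] by (simp add: g_def)
    moreover have "b\<^sup>\<star> * g = b\<^sup>\<star>"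
      using star_proj_absorb[OF E(3), of b] E_idem[OF E(3)] unfolding b_def by (simp add: mult.assoc)
    moreover have "b\<^sup>\<star> * g = g * b\<^sup>\<star>" using E_commute E proj_in_E by simp
    ultimately show ?thesis by simp
  qed
  have cdReg: "c * d \<in> Reg E"
  proof -
    obtain c' d' where c': "inverse_arrows c c'" and d': "inverse_arrows d d'" using c d Reg_iff by auto
    have "c * d * (d' * c') = c * (d * d') * c'" by (simp add: mult.assoc)
    also have "\<dots> = c * c\<^sup>\<star> * c'" using d' cd unfolding inverse_arrows_def by simp
    also have "\<dots> = c\<^sup>\<oplus>" using c' by (simp add: mult_star_proj inverse_arrows_def)
    finally have "inverse_arrows (c * d) (d' * c')"
      using c' d' cd plus_proj_comp[of c d] star_proj_comp[of c d] plus_proj_comp[of d' c'] star_proj_comp[of d' c']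
      by (intro section_iso) (auto simp: inverse_arrows_def)
    then show ?thesis using Reg_iff by blast
  qed
  have bReg: "b \<in> Reg E"
    using parallel_to_iso[OF cdReg, of b] bp bs cd plus_proj_comp star_proj_comp by (simp add: e_def g_def)
  have b': "b\<^sup>\<oplus> * s * t * b\<^sup>\<star> = b" unfolding bp bs by (simp add: b_def)
  note F = Reg_factor[OF bReg b', unfolded bp bs, folded k_def]
  have "k = f" using Reg_same_dom_le[OF F(1) c] F(3,4) kf by (simp add: e_def f_def)
  then show "c\<^sup>\<star> = (c\<^sup>\<oplus> * s)\<^sup>\<star> * (t * d\<^sup>\<star>)\<^sup>\<oplus>" unfolding k_def e_def f_def g_def by simp
  show "c\<^sup>\<oplus> * s * t * d\<^sup>\<star> = c * d"
    using F(7) cf \<open>k = f\<close> unfolding b_def e_def g_def by simp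
qed

text \<open>This is the source of triangularity: restricting lowers the domain unless nothing
  changes. With equal domains, \<open>b\<close> is \<open>a\<close> cut down on the right only, so
  the ranges are comparable and \<open>Reg_same_dom_le\<close> identifies them.\<close>

lemma Reg_restrict:
  assumes "a \<in> Reg E" "b \<in> Reg E" and r: "b\<^sup>\<oplus> * a * b\<^sup>\<star> = b"
  shows "a\<^sup>\<oplus> * b\<^sup>\<oplus> = b\<^sup>\<oplus>" "a\<^sup>\<oplus> = b\<^sup>\<oplus> \<Longrightarrow> a = b"
proof -
  have "b\<^sup>\<oplus> = b\<^sup>\<oplus> * (a * b\<^sup>\<star>)\<^sup>\<oplus>"
    using plus_proj_E_mult[of "b\<^sup>\<oplus>" "a * b\<^sup>\<star>"] r by (simp add: mult.assoc proj_in_E)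
  also have "\<dots> = (a * b\<^sup>\<star>)\<^sup>\<oplus> * b\<^sup>\<oplus>" by (intro E_commute proj_in_E)
  finally have b: "b\<^sup>\<oplus> = (a * b\<^sup>\<star>)\<^sup>\<oplus> * b\<^sup>\<oplus>" .
  have "a\<^sup>\<oplus> * ((a * b\<^sup>\<star>)\<^sup>\<oplus> * b\<^sup>\<oplus>) = (a * b\<^sup>\<star>)\<^sup>\<oplus> * b\<^sup>\<oplus>"
    using plus_proj_mult_le[of a "b\<^sup>\<star>"] by (simp flip: mult.assoc)
  then show "a\<^sup>\<oplus> * b\<^sup>\<oplus> = b\<^sup>\<oplus>" using b by simp
  assume eq: "a\<^sup>\<oplus> = b\<^sup>\<oplus>"
  then have ab: "a * b\<^sup>\<star> = b" using r plus_proj_mult[of a] by simp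
  then have "a\<^sup>\<star> * b\<^sup>\<star> = b\<^sup>\<star>" using star_proj_mult_E[of "b\<^sup>\<star>" a] proj_in_E by metis
  then have "a\<^sup>\<star> = b\<^sup>\<star>" using Reg_same_dom_le assms eq by blast
  then show "a = b" using ab mult_star_proj[of a] by simp
qed

end


section \<open>Left ideals and the Jacobson radical\<close>

lemma (in ring) left_idealI:
  assumes "I \<subseteq> carrier R" "\<zero> \<in> I"
    and "\<And>a b. a \<in> I \<Longrightarrow> b \<in> I \<Longrightarrow> a \<oplus> b \<in> I"
    and lmult: "\<And>r a. r \<in> carrier R \<Longrightarrow> a \<in> I \<Longrightarrow> r \<otimes> a \<in> I"
  shows "left_ideal I R"
  unfolding left_ideal_def
proof
  have inv: "\<ominus> a \<in> I" if "a \<in> I" for a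
  proof -
    have "\<ominus> \<one> \<otimes> a = \<ominus> a" using that assms(1) l_minus[of \<one> a] by auto
    then show ?thesis using lmult[of "\<ominus> \<one>" a] that by simp
  qed
  show "additive_subgroup I R"
    unfolding additive_subgroup_def
    by (rule group.subgroupI[OF a_group]) (use assms inv in \<open>auto simp: a_inv_def\<close>)
qed (use lmult in blast)

lemma left_idealD:
  assumes "left_ideal I R"
  shows "I \<subseteq> carrier R" "\<zero>\<^bsub>R\<^esub> \<in> I" "a \<in> I \<Longrightarrow> b \<in> I \<Longrightarrow> a \<oplus>\<^bsub>R\<^esub> b \<in> I"
    "r \<in> carrier R \<Longrightarrow> a \<in> I \<Longrightarrow> r \<otimes>\<^bsub>R\<^esub> a \<in> I"
  using assms additive_subgroup.a_subset additive_subgroup.zero_closed additive_subgroup.a_closed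
  unfolding left_ideal_def by metis+

lemma (in ring) left_ideal_eq_carrier:
  "left_ideal I R \<Longrightarrow> \<one> \<in> I \<Longrightarrow> I = carrier R"
  using left_idealD(1)[of I R] left_idealD(4)[of I R _ \<one>] by auto

lemma (in ring) maximal_left_ideal_exists:
  assumes L: "left_ideal L R" "\<one> \<notin> L"
  shows "\<exists>I. maximal_left_ideal I R \<and> L \<subseteq> I"
proof -
  let ?A = "{I. left_ideal I R \<and> \<one> \<notin> I \<and> L \<subseteq> I}"
  have "\<exists>I\<in>?A. \<forall>J\<in>?A. I \<subseteq> J \<longrightarrow> J = I"
  proof (rule subset_Zorn_nonempty)
    show "?A \<noteq> {}" using L by blast
    fix \<C> assume ne: "\<C> \<noteq> {}" and chain: "subset.chain ?A \<C>"
    have sub: "\<C> \<subseteq> ?A" and lin: "\<And>X Y. X \<in> \<C> \<Longrightarrow> Y \<in> \<C> \<Longrightarrow> X \<subseteq> Y \<or> Y \<subseteq> X"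
      using chain unfolding subset_chain_def by auto
    have "left_ideal (\<Union>\<C>) R"
    proof (rule left_idealI)
      show "\<Union>\<C> \<subseteq> carrier R" using sub left_idealD(1) by blast
      show "\<zero> \<in> \<Union>\<C>" using sub ne left_idealD(2) by blast
      fix a b assume "a \<in> \<Union>\<C>" "b \<in> \<Union>\<C>"
      then obtain X Y where XY: "X \<in> \<C>" "Y \<in> \<C>" "a \<in> X" "b \<in> Y" by blast
      then obtain Z where "Z \<in> \<C>" "a \<in> Z" "b \<in> Z" using lin[of X Y] by blast
      then show "a \<oplus> b \<in> \<Union>\<C>" using sub left_idealD(3)[of Z R a b] by blast
    next
      fix r a assume "r \<in> carrier R" "a \<in> \<Union>\<C>"
      then show "r \<otimes> a \<in> \<Union>\<C>" using sub left_idealD(4)[of _ R r a] by blast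
    qed
    then show "\<Union>\<C> \<in> ?A" using sub ne by blast
  qed
  then obtain I where I: "left_ideal I R" "\<one> \<notin> I" "L \<subseteq> I"
    and max: "\<And>J. left_ideal J R \<Longrightarrow> \<one> \<notin> J \<Longrightarrow> L \<subseteq> J \<Longrightarrow> I \<subseteq> J \<Longrightarrow> J = I" by auto
  have "maximal_left_ideal I R"
    unfolding maximal_left_ideal_def
  proof (intro conjI allI impI)
    show "left_ideal I R" by fact
    show "I \<noteq> carrier R" using I(2) one_closed by blast
    show "J = I \<or> J = carrier R" if "left_ideal J R" "I \<subseteq> J" for J
      using max[of J] that I(3) left_ideal_eq_carrier by blast
  qed
  then show ?thesis using I(3) by blast
qed

text \<open>Otherwise the left multiples of \<open>\<one> \<ominus> x\<close> lie in a maximal left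
  ideal. It also contains \<open>x\<close>, hence \<open>\<one>\<close>.\<close>

lemma (in ring) jacobson_radical_left_inverse:
  assumes "x \<in> jacobson_radical R"
  shows "\<exists>z\<in>carrier R. z \<otimes> (\<one> \<ominus> x) = \<one>"
proof (rule ccontr)
  assume contra: "\<not> ?thesis"
  have x: "x \<in> carrier R" using assms unfolding jacobson_radical_def by blast
  let ?L = "(\<lambda>z. z \<otimes> (\<one> \<ominus> x)) ` carrier R"
  have L: "left_ideal ?L R"
  proof (rule left_idealI)
    show "?L \<subseteq> carrier R" using x by auto
    show "\<zero> \<in> ?L" using x by (intro image_eqI[of _ _ \<zero>]) auto
    show "a \<oplus> b \<in> ?L" if "a \<in> ?L" "b \<in> ?L" for a b
      using that x by (auto simp: l_distr[symmetric])
    show "r \<otimes> a \<in> ?L" if "r \<in> carrier R" "a \<in> ?L" for r a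
      using that x by (auto simp: m_assoc[symmetric])
  qed
  moreover have "\<one> \<notin> ?L" using contra by auto
  ultimately have "\<exists>I. maximal_left_ideal I R \<and> ?L \<subseteq> I" by (rule maximal_left_ideal_exists)
  then obtain I where I: "maximal_left_ideal I R" "?L \<subseteq> I" by (elim exE conjE)
  then have lI: "left_ideal I R" unfolding maximal_left_ideal_def by blast
  have "x \<in> I" using assms I(1) unfolding jacobson_radical_def by blast
  moreover have "\<one> \<ominus> x \<in> I" using I(2) x by (auto intro!: subsetD[OF I(2)] image_eqI[of _ _ \<one>])
  ultimately have "(\<one> \<ominus> x) \<oplus> x \<in> I" using left_idealD(3)[OF lI] by blast
  moreover have "(\<one> \<ominus> x) \<oplus> x = \<one>" using x by algebra
  ultimately show False using left_ideal_eq_carrier[OF lI] I(1) unfolding maximal_left_ideal_def by simp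
qed

lemma (in ring) left_ideal_jacobson_radical: "left_ideal (jacobson_radical R) R"
proof (rule left_idealI)
  fix a b assume "a \<in> jacobson_radical R" "b \<in> jacobson_radical R"
  then show "a \<oplus> b \<in> jacobson_radical R"
    unfolding jacobson_radical_def maximal_left_ideal_def by (auto intro: left_idealD(3))
next
  fix r a assume "r \<in> carrier R" "a \<in> jacobson_radical R"
  then show "r \<otimes> a \<in> jacobson_radical R"
    unfolding jacobson_radical_def maximal_left_ideal_def by (auto intro: left_idealD(4))
qed (auto simp: jacobson_radical_def maximal_left_ideal_def intro: left_idealD(2))


section \<open>Left ideals of group algebras\<close>

lemma sum_fun_apply: "(\<Sum>i\<in>A. f i) x = (\<Sum>i\<in>A. f i x)"
  by (induction A rule: infinite_finite_induct) auto

text \<open>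
  Maschke's averaging argument: a linear projection of the group algebra onto the left ideal \<open>L\<close>
  is made equivariant, and \<open>\<epsilon>\<close> is the image of the identity element.
\<close>

lemma Maschke_right_identity:
  fixes G (structure) and L :: "('g \<Rightarrow> 'k::field) set"
  assumes G: "group G" "finite (carrier G)" and char: "of_nat (order G) \<noteq> (0::'k)"
    and supp: "\<And>v x. v \<in> L \<Longrightarrow> x \<notin> carrier G \<Longrightarrow> v x = 0"
    and zero: "0 \<in> L" and add: "\<And>v w. v \<in> L \<Longrightarrow> w \<in> L \<Longrightarrow> v + w \<in> L"
    and smult: "\<And>c v. v \<in> L \<Longrightarrow> (\<lambda>x. c * v x) \<in> L"
    and translate: "\<And>g v. g \<in> carrier G \<Longrightarrow> v \<in> L \<Longrightarrow>
      (\<lambda>x. if x \<in> carrier G then v (g \<otimes> x) else 0) \<in> L"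
  shows "\<exists>\<epsilon>\<in>L. \<forall>v\<in>L. \<forall>x\<in>carrier G. (\<Sum>c\<in>carrier G. v c * \<epsilon> (inv c \<otimes> x)) = v x"
proof -
  interpret group G by fact
  interpret fun_space: vector_space "\<lambda>(c::'k) (f::'g \<Rightarrow> 'k) x. c * f x"
    by unfold_locales (auto simp: fun_eq_iff algebra_simps)
  interpret fun_space_pair: vector_space_pair
    "\<lambda>(c::'k) (f::'g \<Rightarrow> 'k) x. c * f x" "\<lambda>(c::'k) (f::'g \<Rightarrow> 'k) x. c * f x"
    by unfold_locales
  have sub: "fun_space.subspace L"
    using zero add smult by (auto simp: fun_space.subspace_def)
  obtain p :: "('g \<Rightarrow> 'k) \<Rightarrow> ('g \<Rightarrow> 'k)" where p: "\<And>v. p v \<in> L" "\<And>v. v \<in> L \<Longrightarrow> p v = v"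
    and lin: "Vector_Spaces.linear (\<lambda>c f x. c * f x) (\<lambda>c f x. c * f x) p"
    using fun_space_pair.linear_exists_left_inverse_on[OF fun_space.linear_id sub] by auto
  interpret p: Vector_Spaces.linear "\<lambda>(c::'k) (f::'g \<Rightarrow> 'k) x. c * f x" "\<lambda>(c::'k) (f::'g \<Rightarrow> 'k) x. c * f x" p
    by (rule lin)
  define \<delta> :: "'g \<Rightarrow> 'g \<Rightarrow> 'k" where "\<delta> g x = (if x = g then 1 else 0)" for g x
  define T :: "'g \<Rightarrow> ('g \<Rightarrow> 'k) \<Rightarrow> 'g \<Rightarrow> 'k"
    where "T g v x = (if x \<in> carrier G then v (g \<otimes> x) else 0)" for g v x
  have T: "T g v \<in> L" if "g \<in> carrier G" "v \<in> L" for g v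
    using translate[OF that] by (simp add: T_def[abs_def])
  \<comment> \<open>\<open>T (inv g)\<close> is left multiplication by \<open>g\<close>. So this is
    the average over \<open>g\<close> of \<open>g p(g^-1 v)\<close> at \<open>v\<close> the identity
    element, that is, the value there of the averaged projection.\<close>
  define \<epsilon> where "\<epsilon> = (\<lambda>x. 1 / of_nat (order G) * (\<Sum>g\<in>carrier G. T (inv g) (p (\<delta> (inv g)))) x)"
  have "\<epsilon> \<in> L" unfolding \<epsilon>_def
    using T p(1) by (intro smult fun_space.subspace_sum[OF sub]) auto
  moreover have "(\<Sum>c\<in>carrier G. v c * \<epsilon> (inv c \<otimes> x)) = v x" if v: "v \<in> L" and x: "x \<in> carrier G" for v x
  proof -
    \<comment> \<open>The sum over \<open>c\<close> is \<open>p\<close> applied to the basis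
      expansion of \<open>h^-1 v\<close>. That vector lies in \<open>L\<close>, so \<open>p\<close>
      fixes it.\<close>
    have *: "(\<Sum>c\<in>carrier G. v c * p (\<delta> (inv h \<otimes> c)) (inv h \<otimes> x)) = v x" if h: "h \<in> carrier G" for h
    proof -
      have "(\<Sum>c\<in>carrier G. (\<lambda>y. v c * \<delta> (inv h \<otimes> c) y)) = T h v"
      proof
        fix y
        show "(\<Sum>c\<in>carrier G. (\<lambda>y. v c * \<delta> (inv h \<otimes> c) y)) y = T h v y"
        proof (cases "y \<in> carrier G")
          case True
          have "(\<Sum>c\<in>carrier G. v c * \<delta> (inv h \<otimes> c) y) = (\<Sum>c\<in>carrier G. if c = h \<otimes> y then v c else 0)"
            using True h by (intro sum.cong) (auto simp: \<delta>_def inv_solve_left m_assoc[symmetric])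
          then show ?thesis using True h G(2) by (simp add: sum_fun_apply T_def)
        qed (auto simp: sum_fun_apply T_def \<delta>_def h intro!: sum.neutral)
      qed
      then have "p (\<Sum>c\<in>carrier G. (\<lambda>y. v c * \<delta> (inv h \<otimes> c) y)) (inv h \<otimes> x) = T h v (inv h \<otimes> x)"
        using p(2)[OF T[OF h v]] by simp
      then show ?thesis
        using h x by (simp add: p.sum p.scale sum_fun_apply T_def m_assoc[symmetric])
    qed
    have "(\<Sum>c\<in>carrier G. v c * \<epsilon> (inv c \<otimes> x)) = 1 / of_nat (order G) *
        (\<Sum>c\<in>carrier G. \<Sum>g\<in>carrier G. v c * p (\<delta> (inv g)) (inv g \<otimes> (inv c \<otimes> x)))"
      using x by (simp add: \<epsilon>_def sum_fun_apply T_def sum_distrib_left mult_ac)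
    \<comment> \<open>Substitute \<open>h = c g\<close>, which moves the dependence on
      \<open>c\<close> into the argument of \<open>p\<close>.\<close>
    also have "(\<Sum>c\<in>carrier G. \<Sum>g\<in>carrier G. v c * p (\<delta> (inv g)) (inv g \<otimes> (inv c \<otimes> x))) =
        (\<Sum>c\<in>carrier G. \<Sum>h\<in>carrier G. v c * p (\<delta> (inv h \<otimes> c)) (inv h \<otimes> x))"
    proof (rule sum.cong[OF refl])
      fix c assume c: "c \<in> carrier G"
      show "(\<Sum>g\<in>carrier G. v c * p (\<delta> (inv g)) (inv g \<otimes> (inv c \<otimes> x))) =
        (\<Sum>h\<in>carrier G. v c * p (\<delta> (inv h \<otimes> c)) (inv h \<otimes> x))"
        using c x
        by (intro sum.reindex_bij_witness[of _ "\<lambda>h. inv c \<otimes> h" "\<lambda>g. c \<otimes> g"])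
          (auto simp: inv_mult_group m_assoc[symmetric], simp_all add: m_assoc)
    qed
    also have "\<dots> = (\<Sum>h\<in>carrier G. v x)"
      by (subst sum.swap) (simp add: * cong: sum.cong)
    also have "1 / of_nat (order G) * \<dots> = v x" using char by (simp add: order_def)
    finally show ?thesis .
  qed
  ultimately show ?thesis by blast
qed


section \<open>The algebra of a finite semigroup\<close>

definition basis_elt :: "'a \<Rightarrow> 'a \<Rightarrow> 'k::field" where
  "basis_elt s = (\<lambda>x. if x = s then 1 else 0)"

lemma semigroup_algebra_simps [simp]:
  "carrier (semigroup_algebra T) = fin_supp_on T"
  "mult (semigroup_algebra T) = conv"
  "zero (semigroup_algebra T) = 0"
  "add (semigroup_algebra T) = (+)"
  "smult (semigroup_algebra T) = (\<lambda>c f x. c * f x)"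
  unfolding semigroup_algebra_def by (auto simp: fun_eq_iff)

lemma fin_supp_on_finite: "fin_supp_on T = {f :: 'a::finite \<Rightarrow> 'k::field. \<forall>x. x \<notin> T \<longrightarrow> f x = 0}"
  unfolding fin_supp_on_def by auto

text \<open>Sets \<open>B\<close> other than singletons matter because a coefficient of
  \<open>iso_coeff\<close> sums over all elements with a given restriction. Associativity uses the
  same form.\<close>

lemma sum_conv:
  fixes f g :: "'a::{semigroup_mult, finite} \<Rightarrow> 'k::field"
  shows "(\<Sum>x\<in>B. conv f g x) = (\<Sum>y\<in>UNIV. \<Sum>z\<in>UNIV. if y * z \<in> B then f y * g z else 0)"
proof -
  have conv: "conv f g x = (\<Sum>(y, z)\<in>UNIV. if y * z = x then f y * g z else 0)" for x
    unfolding conv_def by (rule sum.mono_neutral_cong_left) (auto split: if_splits)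
  have "(\<Sum>x\<in>B. conv f g x) = (\<Sum>(y, z)\<in>UNIV. \<Sum>x\<in>B. if y * z = x then f y * g z else 0)"
    unfolding conv by (subst sum.swap) (simp add: case_prod_unfold)
  also have "\<dots> = (\<Sum>(y, z)\<in>UNIV. if y * z \<in> B then f y * g z else 0)"
    by (intro sum.cong) (auto simp: case_prod_unfold)
  finally show ?thesis by (simp add: sum.cartesian_product)
qed

lemma conv_eq_sum:
  fixes f g :: "'a::{semigroup_mult, finite} \<Rightarrow> 'k::field"
  shows "conv f g x = (\<Sum>y\<in>UNIV. \<Sum>z\<in>UNIV. if y * z = x then f y * g z else 0)"
  using sum_conv[of f g "{x}"] by simp

lemma conv_basis_elt: "conv (basis_elt s) (basis_elt t) = (basis_elt (s * t) :: 'a::{semigroup_mult, finite} \<Rightarrow> 'k::field)"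
proof
  fix x
  have "conv (basis_elt s) (basis_elt t) x = (\<Sum>y\<in>UNIV. \<Sum>z\<in>UNIV. if z = t then
      if y = s then if s * t = x then 1 else (0::'k) else 0 else 0)"
    unfolding conv_eq_sum basis_elt_def by (intro sum.cong refl) auto
  then show "conv (basis_elt s) (basis_elt t) x = (basis_elt (s * t) x :: 'k)"
    by (auto simp: basis_elt_def)
qed

context
  fixes f g h :: "'a::{semigroup_mult, finite} \<Rightarrow> 'k::field"
begin

lemma conv_add_left: "conv (f + g) h = conv f h + conv g h"
  by (simp add: fun_eq_iff conv_eq_sum algebra_simps flip: sum.distrib)
    (intro allI sum.cong refl, auto simp: distrib_right)

lemma conv_add_right: "conv h (f + g) = conv h f + conv h g"
  by (simp add: fun_eq_iff conv_eq_sum algebra_simps flip: sum.distrib)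
    (intro allI sum.cong refl, auto simp: distrib_left)

lemma conv_smult_left: "conv (\<lambda>x. c * f x) g = (\<lambda>x. c * conv f g x)"
  by (simp add: fun_eq_iff conv_eq_sum sum_distrib_left)
    (intro allI sum.cong refl, auto)

lemma conv_zero_right: "conv f 0 = 0"
  by (simp add: fun_eq_iff conv_eq_sum cong: if_cong)

lemma conv_assoc: "conv (conv f g) h = conv f (conv g h)"
proof
  fix x
  have "conv (conv f g) h x = (\<Sum>z\<in>UNIV. h z * (\<Sum>y | y * z = x. conv f g y))"
    unfolding conv_eq_sum[of "conv f g"]
    by (subst sum.swap) (auto simp: sum_distrib_left sum.If_cases mult.commute intro!: sum.cong)
  also have "\<dots> = (\<Sum>z\<in>UNIV. \<Sum>s\<in>UNIV. \<Sum>t\<in>UNIV. if s * t * z = x then f s * g t * h z else 0)"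
    unfolding sum_conv by (auto simp: sum_distrib_left intro!: sum.cong)
  also have "\<dots> = (\<Sum>s\<in>UNIV. \<Sum>z\<in>UNIV. \<Sum>t\<in>UNIV. if s * t * z = x then f s * g t * h z else 0)"
    by (rule sum.swap)
  also have "\<dots> = (\<Sum>s\<in>UNIV. \<Sum>t\<in>UNIV. \<Sum>z\<in>UNIV. if s * t * z = x then f s * g t * h z else 0)"
    by (intro sum.cong refl sum.swap)
  also have "\<dots> = (\<Sum>s\<in>UNIV. f s * (\<Sum>y | s * y = x. conv g h y))"
    unfolding sum_conv by (auto simp: sum_distrib_left mult.assoc intro!: sum.cong)
  also have "\<dots> = conv f (conv g h) x"
    unfolding conv_eq_sum[of f "conv g h"]
    by (auto simp: sum_distrib_left sum.If_cases intro!: sum.cong)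
  finally show "conv (conv f g) h x = conv f (conv g h) x" .
qed

lemma conv_expand_right: "conv f g x = (\<Sum>s\<in>UNIV. g s * conv f (basis_elt s) x)"
proof -
  have "conv f (basis_elt s) x = (\<Sum>y\<in>UNIV. if y * s = x then f y else 0)" for s
  proof -
    have "conv f (basis_elt s) x =
        (\<Sum>y\<in>UNIV. \<Sum>z\<in>UNIV. if z = s then if y * s = x then f y else 0 else 0)"
      unfolding conv_eq_sum basis_elt_def by (intro sum.cong refl) auto
    then show ?thesis by simp
  qed
  then have "(\<Sum>s\<in>UNIV. g s * conv f (basis_elt s) x) =
      (\<Sum>s\<in>UNIV. \<Sum>y\<in>UNIV. if y * s = x then f y * g s else 0)"
    by (auto simp: sum_distrib_left mult.commute intro!: sum.cong)
  also have "\<dots> = conv f g x" unfolding conv_eq_sum by (rule sum.swap)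
  finally show ?thesis by simp
qed

lemma conv_expand_left: "conv f g x = (\<Sum>s\<in>UNIV. f s * conv (basis_elt s) g x)"
proof -
  have "conv (basis_elt s) g x = (\<Sum>y\<in>UNIV. if s * y = x then g y else 0)" for s
  proof -
    have "conv (basis_elt s) g x =
        (\<Sum>y\<in>UNIV. if y = s then \<Sum>z\<in>UNIV. if s * z = x then g z else 0 else 0)"
      unfolding conv_eq_sum basis_elt_def by (intro sum.cong refl) (auto cong: if_cong intro!: sum.neutral)
    then show ?thesis by simp
  qed
  then show ?thesis
    unfolding conv_eq_sum by (auto simp: sum_distrib_left intro!: sum.cong)
qed

end

lemma conv_closed:
  assumes "\<And>s t. s \<in> T \<Longrightarrow> t \<in> T \<Longrightarrow> s * t \<in> T" "f \<in> fin_supp_on T" "g \<in> fin_supp_on T"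
  shows "conv f g \<in> fin_supp_on (T :: 'a::{semigroup_mult, finite} set)"
  using assms by (force simp: fin_supp_on_finite conv_eq_sum intro!: sum.neutral)

lemma conv_commute:
  assumes "\<And>s t. s \<in> T \<Longrightarrow> t \<in> T \<Longrightarrow> s * t = t * s" "f \<in> fin_supp_on T" "g \<in> fin_supp_on T"
  shows "conv f g = conv g (f :: 'a::{semigroup_mult, finite} \<Rightarrow> 'k::field)"
proof
  fix x
  have "(if s * t = x then f s * g t else 0) = (if t * s = x then g t * f s else 0)" for s t
    using assms by (cases "s \<in> T \<and> t \<in> T") (auto simp: fin_supp_on_finite)
  then show "conv f g x = conv g f x"
    unfolding conv_eq_sum by (subst sum.swap) simp
qed

lemma one_semigroup_algebra:
  fixes u :: "'a::semigroup_mult \<Rightarrow> 'k::field"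
  assumes "u \<in> fin_supp_on T" "\<And>f. f \<in> fin_supp_on T \<Longrightarrow> conv u f = f \<and> conv f u = f"
  shows "one (semigroup_algebra T) = u"
  unfolding semigroup_algebra_def using assms by (auto intro!: the_equality)

lemma ring_semigroup_algebra:
  fixes u :: "'a::{semigroup_mult, finite} \<Rightarrow> 'k::field"
  assumes u: "\<And>f. conv u f = f" "\<And>f. conv f u = f"
  shows "ring (semigroup_algebra UNIV :: ('k, 'a \<Rightarrow> 'k) module)"
proof (rule ringI)
  show "abelian_group (semigroup_algebra UNIV :: ('k, 'a \<Rightarrow> 'k) module)"
  proof (rule abelian_groupI)
    fix x :: "'a \<Rightarrow> 'k"
    have "\<exists>y. y + x = 0" by (intro exI[of _ "- x"]) simp
    then show "\<exists>y\<in>carrier (semigroup_algebra UNIV). y \<oplus>\<^bsub>semigroup_algebra UNIV\<^esub> x = \<zero>\<^bsub>semigroup_algebra UNIV\<^esub>"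
      by (auto simp: fin_supp_on_finite)
  qed (auto simp: fin_supp_on_finite add_ac)
  have "\<one>\<^bsub>semigroup_algebra UNIV\<^esub> = u"
    using u by (intro one_semigroup_algebra) (auto simp: fin_supp_on_finite)
  then show "monoid (semigroup_algebra UNIV :: ('k, 'a \<Rightarrow> 'k) module)"
    using u by (intro monoidI) (auto simp: fin_supp_on_finite conv_assoc)
qed (auto simp: conv_add_left conv_add_right)


section \<open>The homomorphism onto the groupoid algebra\<close>

context finite_EI_Ehresmann_semigroup
begin

text \<open>
  The target of this homomorphism is the algebra of the groupoid \<open>Reg E\<close>, in which the product of
  non-composable arrows is zero: an element \<open>s\<close> is sent to the sum of the isomorphisms among its
  restrictions \<open>e s f\<close> that are arrows from \<open>e\<close> to \<open>f\<close>.
\<close>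

definition iso_coeff :: "('a \<Rightarrow> 'k::field) \<Rightarrow> 'a \<Rightarrow> 'k" where
  "iso_coeff x b = (if b \<in> Reg E then \<Sum>s | b\<^sup>\<oplus> * s * b\<^sup>\<star> = b. x s else 0)"

lemma iso_coeff_add: "iso_coeff (x + y) = iso_coeff x + iso_coeff y"
  by (auto simp: fun_eq_iff iso_coeff_def sum.distrib)

lemma iso_coeff_diff: "iso_coeff (x - y) = iso_coeff x - iso_coeff y"
  by (auto simp: fun_eq_iff iso_coeff_def sum_subtractf)

lemma iso_coeff_smult: "iso_coeff (\<lambda>s. c * x s) = (\<lambda>b. c * iso_coeff x b)"
  by (auto simp: fun_eq_iff iso_coeff_def sum_distrib_left)

lemma iso_coeff_zero: "iso_coeff 0 = 0"
  by (auto simp: fun_eq_iff iso_coeff_def)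

lemma iso_coeff_sum: "iso_coeff (\<Sum>i\<in>I. x i) = (\<Sum>i\<in>I. iso_coeff (x i))"
  by (induction I rule: infinite_finite_induct) (simp_all add: iso_coeff_zero iso_coeff_add del: zero_fun_apply plus_fun_apply)

lemma iso_coeff_mem: "iso_coeff x \<in> fin_supp_on (Reg E)"
  by (auto simp: fin_supp_on_finite iso_coeff_def)

text \<open>The index set for the coefficient of \<open>b\<close> in a product of the groupoid
  algebra.\<close>

definition factorizations :: "'a \<Rightarrow> ('a \<times> 'a) set" where
  "factorizations b = {(c, d). c \<in> Reg E \<and> d \<in> Reg E \<and> c\<^sup>\<star> = d\<^sup>\<oplus> \<and> c * d = b}"

lemma factorizations_proj:
  assumes "(c, d) \<in> factorizations b"
  shows "c\<^sup>\<oplus> = b\<^sup>\<oplus>" "d\<^sup>\<star> = b\<^sup>\<star>" "c\<^sup>\<star> = d\<^sup>\<oplus>"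
  using assms plus_proj_comp[of c d] star_proj_comp[of c d] unfolding factorizations_def by auto

text \<open>Multiplicativity: the right-hand side is the coefficient of the product in the groupoid
  algebra.\<close>

lemma iso_coeff_conv:
  assumes b: "b \<in> Reg E"
  shows "iso_coeff (conv x y) b = (\<Sum>(c, d)\<in>factorizations b. iso_coeff x c * iso_coeff y d)"
proof -
  define S where "S c = {s. c\<^sup>\<oplus> * s * c\<^sup>\<star> = c}" for c
  define B where "B = {(s, t). b\<^sup>\<oplus> * (s * t) * b\<^sup>\<star> = b}"
  \<comment> \<open>\<open>F\<close> records pairs \<open>(s, t)\<close> together with the
    factorization of \<open>b\<close> to which they restrict. Forgetting the factorization is onto
    \<open>B\<close> by \<open>Reg_factor\<close> and injective by
    \<open>Reg_factor_unique\<close>.\<close>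
  define F where "F = Sigma (factorizations b) (\<lambda>(c, d). S c \<times> S d)"
  have unique: "b\<^sup>\<oplus> * s * t * b\<^sup>\<star> = b \<and> c = b\<^sup>\<oplus> * s * ((b\<^sup>\<oplus> * s)\<^sup>\<star> * (t * b\<^sup>\<star>)\<^sup>\<oplus>) \<and>
      d = (b\<^sup>\<oplus> * s)\<^sup>\<star> * (t * b\<^sup>\<star>)\<^sup>\<oplus> * t * b\<^sup>\<star>"
    if "((c, d), (s, t)) \<in> F" for c d s t
  proof -
    have cd: "(c, d) \<in> factorizations b" and s: "c\<^sup>\<oplus> * s * c\<^sup>\<star> = c" and t: "d\<^sup>\<oplus> * t * d\<^sup>\<star> = d"
      using that unfolding F_def S_def by auto
    note p = factorizations_proj[OF cd]
    have "c \<in> Reg E" "d \<in> Reg E" "c * d = b" using cd unfolding factorizations_def by auto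
    note u = Reg_factor_unique[OF this(1,2) p(3) s t]
    show ?thesis using u s t p \<open>c * d = b\<close> by metis
  qed
  have bij: "bij_betw snd F B"
  proof (rule bij_betwI')
    show "(snd p = snd q) = (p = q)" if "p \<in> F" "q \<in> F" for p q
    proof
      obtain c d s t c' d' s' t' where pq: "p = ((c, d), (s, t))" "q = ((c', d'), (s', t'))"
        by (metis surj_pair)
      assume "snd p = snd q"
      then have st: "s' = s" "t' = t" using pq by auto
      show "p = q" using unique[of c d s t] unique[of c' d' s' t'] that unfolding pq st by simp
    qed simp
    show "snd p \<in> B" if "p \<in> F" for p
    proof -
      obtain c d s t where p: "p = ((c, d), (s, t))" by (metis surj_pair)
      show ?thesis using unique[of c d s t] that unfolding p B_def by (simp add: mult.assoc)
    qed
    show "\<exists>p\<in>F. q = snd p" if "q \<in> B" for q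
    proof -
      obtain s t where q: "q = (s, t)" by (metis surj_pair)
      have st: "b\<^sup>\<oplus> * s * t * b\<^sup>\<star> = b" using that unfolding q B_def by (simp add: mult.assoc)
      define k where "k = (b\<^sup>\<oplus> * s)\<^sup>\<star> * (t * b\<^sup>\<star>)\<^sup>\<oplus>"
      note f = Reg_factor[OF b st, folded k_def]
      have "(b\<^sup>\<oplus> * s * k, k * t * b\<^sup>\<star>) \<in> factorizations b"
        unfolding factorizations_def using f by simp
      moreover have "s \<in> S (b\<^sup>\<oplus> * s * k)" "t \<in> S (k * t * b\<^sup>\<star>)"
        unfolding S_def using f by simp_all
      ultimately show ?thesis unfolding q F_def
        by (intro bexI[of _ "((b\<^sup>\<oplus> * s * k, k * t * b\<^sup>\<star>), (s, t))"]) auto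
    qed
  qed
  have "(\<Sum>(c, d)\<in>factorizations b. iso_coeff x c * iso_coeff y d) =
      (\<Sum>(c, d)\<in>factorizations b. \<Sum>(s, t)\<in>S c \<times> S d. x s * y t)"
    by (intro sum.cong refl)
      (auto simp: factorizations_def iso_coeff_def S_def sum_product sum.cartesian_product)
  also have "\<dots> = (\<Sum>((c, d), (s, t))\<in>F. x s * y t)"
    unfolding F_def by (subst sum.Sigma[symmetric]) (auto simp: case_prod_unfold)
  also have "\<dots> = (\<Sum>p\<in>F. (\<lambda>(s, t). x s * y t) (snd p))"
    by (simp add: case_prod_unfold)
  also have "\<dots> = (\<Sum>(s, t)\<in>B. x s * y t)"
    by (rule sum.reindex_bij_betw[OF bij])
  also have "\<dots> = (\<Sum>(s, t)\<in>UNIV. if b\<^sup>\<oplus> * (s * t) * b\<^sup>\<star> = b then x s * y t else 0)"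
    unfolding B_def by (rule sum.mono_neutral_cong_left) (auto split: if_splits)
  also have "\<dots> = (\<Sum>s\<in>UNIV. \<Sum>t\<in>UNIV. if b\<^sup>\<oplus> * (s * t) * b\<^sup>\<star> = b then x s * y t else 0)"
    by (simp add: sum.cartesian_product)
  also have "\<dots> = iso_coeff (conv x y) b"
    using b by (simp add: iso_coeff_def sum_conv)
  finally show ?thesis by simp
qed

lemma iso_coeff_conv_eq_zero:
  "iso_coeff x = 0 \<Longrightarrow> iso_coeff (conv x y) = 0"
  "iso_coeff y = 0 \<Longrightarrow> iso_coeff (conv x y) = 0"
proof -
  show "iso_coeff (conv x y) = 0" if "iso_coeff x = 0"
  proof
    show "iso_coeff (conv x y) b = 0 b" for b
      using that by (cases "b \<in> Reg E") (simp add: iso_coeff_conv, simp add: iso_coeff_def)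
  qed
  show "iso_coeff (conv x y) = 0" if "iso_coeff y = 0"
  proof
    show "iso_coeff (conv x y) b = 0 b" for b
      using that by (cases "b \<in> Reg E") (simp add: iso_coeff_conv, simp add: iso_coeff_def)
  qed
qed

text \<open>A lift of an arrow \<open>g\<close> acts on coefficients as \<open>g\<close> itself does
  in the groupoid algebra, since \<open>(g, g' * b)\<close> is the only factorization of
  \<open>b\<close> that starts with \<open>g\<close>. The radical can thus be moved around along
  arrows.\<close>

lemma iso_coeff_conv_basis_left:
  assumes g: "inverse_arrows g g'" and x: "iso_coeff x = basis_elt g" and b: "b \<in> Reg E"
  shows "iso_coeff (conv x y) b = (if b\<^sup>\<oplus> = g\<^sup>\<oplus> then iso_coeff y (g' * b) else 0)"
proof -
  have "iso_coeff (conv x y) b = (\<Sum>(c, d)\<in>factorizations b. if c = g then iso_coeff y d else 0)"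
    unfolding iso_coeff_conv[OF b] x by (intro sum.cong refl) (auto simp: basis_elt_def)
  also have "\<dots> = (\<Sum>(c, d)\<in>{p \<in> factorizations b. fst p = g}. iso_coeff y d)"
    by (rule sum.mono_neutral_cong_right) (auto split: if_splits)
  also have "{p \<in> factorizations b. fst p = g} = (if b\<^sup>\<oplus> = g\<^sup>\<oplus> then {(g, g' * b)} else {})"
  proof (cases "b\<^sup>\<oplus> = g\<^sup>\<oplus>")
    case True
    have unique: "d = g' * b" if "(g, d) \<in> factorizations b" for d
    proof -
      have "g' * b = g' * g * d" using that unfolding factorizations_def by (auto simp: mult.assoc)
      also have "\<dots> = d\<^sup>\<oplus> * d"
        using g factorizations_proj(3)[OF that] unfolding inverse_arrows_def by simp
      finally show ?thesis by (simp add: plus_proj_mult)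
    qed
    have factor: "(g, g' * b) \<in> factorizations b"
    proof -
      obtain b' where b': "inverse_arrows b b'" using b Reg_iff by auto
      have comp: "g'\<^sup>\<star> = b\<^sup>\<oplus>" "b'\<^sup>\<star> = g\<^sup>\<oplus>" "b\<^sup>\<star> = b'\<^sup>\<oplus>" "g'\<^sup>\<oplus> = g\<^sup>\<star>"
        using g b' True unfolding inverse_arrows_def by auto
      have p: "(g' * b)\<^sup>\<oplus> = g'\<^sup>\<oplus>" "(g' * b)\<^sup>\<star> = b\<^sup>\<star>" "(b' * g)\<^sup>\<oplus> = b'\<^sup>\<oplus>" "(b' * g)\<^sup>\<star> = g\<^sup>\<star>"
        using comp plus_proj_comp star_proj_comp by auto
      have "g' * b * (b' * g) = g' * (b * b') * g" by (simp add: mult.assoc)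
      also have "b * b' = g'\<^sup>\<star>" using b' comp unfolding inverse_arrows_def by simp
      also have "g' * g'\<^sup>\<star> * g = g\<^sup>\<star>" using g unfolding mult_star_proj by (simp add: inverse_arrows_def)
      finally have "inverse_arrows (g' * b) (b' * g)"
        using p comp by (intro section_iso) simp_all
      then have "g' * b \<in> Reg E" using Reg_iff by blast
      moreover have "g * (g' * b) = b"
        using g True plus_proj_mult[of b] unfolding inverse_arrows_def by (simp flip: mult.assoc)
      ultimately show ?thesis unfolding factorizations_def using g p comp Reg_iff by auto
    qed
    show ?thesis unfolding if_P[OF True]
    proof (intro equalityI subsetI)
      fix p assume "p \<in> {p \<in> factorizations b. fst p = g}"
      then have "p = (g, snd p)" "(g, snd p) \<in> factorizations b" by auto
      then show "p \<in> {(g, g' * b)}" using unique[of "snd p"] by simp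
    qed (use factor in simp)
  next
    case False
    have "fst p \<noteq> g" if "p \<in> factorizations b" for p
      using False factorizations_proj(1)[of "fst p" "snd p" b] that by auto
    then show ?thesis using False by auto
  qed
  finally show ?thesis by simp
qed

section \<open>Unitriangularity on the span of \<open>Reg E\<close>\<close>

definition proj_rank :: "'a \<Rightarrow> nat" where
  "proj_rank a = card {e \<in> E. a\<^sup>\<oplus> * e = e}"

text \<open>The rank turns the order of domains into an order of numbers, for choosing extremal
  elements and for induction.\<close>

lemma proj_rank_less:
  assumes le: "a\<^sup>\<oplus> * b\<^sup>\<oplus> = b\<^sup>\<oplus>" and ne: "a\<^sup>\<oplus> \<noteq> b\<^sup>\<oplus>"
  shows "proj_rank b < proj_rank a"
  unfolding proj_rank_def
proof (rule psubset_card_mono)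
  show "{e \<in> E. b\<^sup>\<oplus> * e = e} \<subset> {e \<in> E. a\<^sup>\<oplus> * e = e}"
  proof
    show "{e \<in> E. b\<^sup>\<oplus> * e = e} \<subseteq> {e \<in> E. a\<^sup>\<oplus> * e = e}"
    proof clarify
      fix e assume e: "b\<^sup>\<oplus> * e = e"
      have "a\<^sup>\<oplus> * (b\<^sup>\<oplus> * e) = b\<^sup>\<oplus> * e" using le by (simp flip: mult.assoc)
      then show "a\<^sup>\<oplus> * e = e" unfolding e .
    qed
    have "a\<^sup>\<oplus> \<in> {e \<in> E. a\<^sup>\<oplus> * e = e}" by (simp add: proj_in_E E_idem)
    moreover have "b\<^sup>\<oplus> * a\<^sup>\<oplus> \<noteq> a\<^sup>\<oplus>" using le ne E_commute[OF proj_in_E(1) proj_in_E(1), of a b] by simp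
    ultimately show "{e \<in> E. b\<^sup>\<oplus> * e = e} \<noteq> {e \<in> E. a\<^sup>\<oplus> * e = e}" by blast
  qed
qed simp

lemma Reg_restrict_rank:
  assumes "a \<in> Reg E" "b \<in> Reg E" "b\<^sup>\<oplus> * a * b\<^sup>\<star> = b" "a \<noteq> b"
  shows "proj_rank b < proj_rank a"
  using Reg_restrict[OF assms(1-3)] assms(4) by (intro proj_rank_less) auto

text \<open>At a support element \<open>a\<close> of maximal rank the coefficient survives: any
  other support element restricting to \<open>a\<close> would have larger rank.\<close>

lemma iso_coeff_inj:
  assumes r: "r \<in> fin_supp_on (Reg E)" and zero: "iso_coeff r = 0"
  shows "r = 0"
proof (rule ccontr)
  assume "r \<noteq> 0"
  then obtain s where "r s \<noteq> 0" by (auto simp: fun_eq_iff)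
  then obtain a where a: "r a \<noteq> 0" and max: "\<And>s. r s \<noteq> 0 \<Longrightarrow> proj_rank s \<le> proj_rank a"
    \<comment> \<open>The successor is there because the lemma asks for a strict upper
      bound.\<close>
    using arg_max_nat_lemma[of "\<lambda>s. r s \<noteq> 0" s proj_rank "Max (range proj_rank) + 1"]
    by (auto simp: le_imp_less_Suc)
  have supp: "s \<in> Reg E" if "r s \<noteq> 0" for s using r that by (auto simp: fin_supp_on_finite)
  have "r s = 0" if "a\<^sup>\<oplus> * s * a\<^sup>\<star> = a" "s \<noteq> a" for s
    using Reg_restrict_rank[of s a] max[of s] supp[of s] supp[OF a] that by (metis linorder_not_le)
  then have "(\<Sum>s | a\<^sup>\<oplus> * s * a\<^sup>\<star> = a. r s) = (\<Sum>s\<in>{a}. r s)"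
    by (intro sum.mono_neutral_right) (auto simp: plus_proj_mult mult_star_proj)
  then have "iso_coeff r a = r a" using supp[OF a] by (simp add: iso_coeff_def)
  then show False using a zero by simp
qed

lemma fin_supp_on_closed:
  "\<lbrakk>x \<in> fin_supp_on T; y \<in> fin_supp_on T\<rbrakk> \<Longrightarrow> x + y \<in> fin_supp_on T"
  "\<lbrakk>x \<in> fin_supp_on T; y \<in> fin_supp_on T\<rbrakk> \<Longrightarrow> x - y \<in> fin_supp_on T"
  "x \<in> fin_supp_on T \<Longrightarrow> (\<lambda>s. c * x s) \<in> fin_supp_on T"
  "(\<And>i. i \<in> I \<Longrightarrow> z i \<in> fin_supp_on T) \<Longrightarrow> (\<Sum>i\<in>I. z i) \<in> fin_supp_on T"
  for x y :: "'a \<Rightarrow> 'k::field"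
  by (auto simp: fin_supp_on_finite sum_fun_apply)

text \<open>The image of \<open>basis_elt b\<close> is itself plus basis elements of strictly
  smaller rank. Their preimages exist by induction and are subtracted.\<close>

lemma iso_coeff_surj_basis:
  "b \<in> Reg E \<Longrightarrow> \<exists>r\<in>fin_supp_on (Reg E). iso_coeff r = (basis_elt b :: 'a \<Rightarrow> 'k::field)"
proof (induction b rule: measure_induct_rule[where f = proj_rank])
  case (less b)
  define L where "L = {c \<in> Reg E. c \<noteq> b \<and> c\<^sup>\<oplus> * b * c\<^sup>\<star> = c}"
  have "\<exists>r\<in>fin_supp_on (Reg E). iso_coeff r = (basis_elt c :: 'a \<Rightarrow> 'k)" if "c \<in> L" for c
    using that less Reg_restrict_rank[of b c] unfolding L_def by auto
  then obtain r where r: "\<And>c. c \<in> L \<Longrightarrow> r c \<in> fin_supp_on (Reg E)"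
      "\<And>c. c \<in> L \<Longrightarrow> iso_coeff (r c) = (basis_elt c :: 'a \<Rightarrow> 'k)"
    by metis
  have "iso_coeff (basis_elt b) = basis_elt b + (\<Sum>c\<in>L. basis_elt c :: 'a \<Rightarrow> 'k)"
  proof
    fix a
    have "iso_coeff (basis_elt b) a = (if a \<in> Reg E \<and> a\<^sup>\<oplus> * b * a\<^sup>\<star> = a then 1 else (0::'k))"
      by (auto simp: iso_coeff_def basis_elt_def sum.delta)
    moreover have "(\<Sum>c\<in>L. basis_elt c a) = (if a \<in> L then 1 else (0::'k))"
      by (simp add: basis_elt_def)
    ultimately show "iso_coeff (basis_elt b) a = (basis_elt b + (\<Sum>c\<in>L. basis_elt c :: 'a \<Rightarrow> 'k)) a"
      using less.prems by (auto simp: sum_fun_apply L_def basis_elt_def plus_proj_mult mult_star_proj)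
  qed
  then have "iso_coeff (basis_elt b - (\<Sum>c\<in>L. r c)) = (basis_elt b :: 'a \<Rightarrow> 'k)"
    by (simp add: iso_coeff_diff iso_coeff_sum r(2))
  moreover have "basis_elt b - (\<Sum>c\<in>L. r c) \<in> fin_supp_on (Reg E)"
    using less.prems r(1) by (intro fin_supp_on_closed) (auto simp: fin_supp_on_finite basis_elt_def)
  ultimately show ?case by blast
qed

lemma iso_coeff_surj:
  fixes v :: "'a \<Rightarrow> 'k::field"
  assumes v: "v \<in> fin_supp_on (Reg E)"
  shows "\<exists>r\<in>fin_supp_on (Reg E). iso_coeff r = v"
proof -
  obtain r where r: "\<And>b. b \<in> Reg E \<Longrightarrow> r b \<in> fin_supp_on (Reg E)"
      "\<And>b. b \<in> Reg E \<Longrightarrow> iso_coeff (r b) = (basis_elt b :: 'a \<Rightarrow> 'k)"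
    using iso_coeff_surj_basis by metis
  define x where "x = (\<Sum>b\<in>Reg E. (\<lambda>s. v b * r b s))"
  have "iso_coeff x = v"
  proof
    fix a
    have "iso_coeff x a = (\<Sum>b\<in>Reg E. v b * basis_elt b a)"
      by (simp add: x_def iso_coeff_sum iso_coeff_smult r(2) sum_fun_apply)
    also have "\<dots> = v a" using v by (auto simp: basis_elt_def fin_supp_on_finite if_distrib cong: if_cong)
    finally show "iso_coeff x a = v a" .
  qed
  moreover have "x \<in> fin_supp_on (Reg E)"
    unfolding x_def using r(1) by (intro fin_supp_on_closed)
  ultimately show ?thesis by blast
qed


section \<open>The radical of the semigroup algebra\<close>

text \<open>Every \<open>s\<close> absorbs its two projections, so it suffices to find a combination
  of \<open>E\<close> that fixes each element of \<open>E\<close>. Its support in \<open>E\<close>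
  lets the same element be the identity of both algebras in the theorem.\<close>

lemma unit_exists:
  "\<exists>u\<in>fin_supp_on E. \<forall>f. conv u f = f \<and> conv f u = (f :: 'a \<Rightarrow> 'k::field)"
proof -
  have basis: "basis_elt e \<in> fin_supp_on E" if "e \<in> E" for e
    using that by (auto simp: fin_supp_on_finite basis_elt_def)
  have closed: "conv f g \<in> fin_supp_on E" and comm: "conv f g = conv g f"
    if "f \<in> fin_supp_on E" "g \<in> fin_supp_on E" for f g :: "'a \<Rightarrow> 'k"
    using that conv_closed[of E] conv_commute[of E] E_closed E_commute by blast+
  have diff: "conv (f - g) h = conv f h - conv g h" for f g h :: "'a \<Rightarrow> 'k"
    using conv_add_left[of "f - g" g h] by (simp add: eq_diff_eq)
  have "finite F \<Longrightarrow> F \<subseteq> E \<Longrightarrow> \<exists>u\<in>fin_supp_on E. \<forall>e\<in>F. conv u (basis_elt e) = (basis_elt e :: 'a \<Rightarrow> 'k)" for F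
  proof (induction F rule: finite_induct)
    case empty
    have "(0 :: 'a \<Rightarrow> 'k) \<in> fin_supp_on E" by (simp add: fin_supp_on_finite)
    then show ?case by blast
  next
    case (insert e F)
    then obtain u where u: "u \<in> fin_supp_on E" "\<And>f. f \<in> F \<Longrightarrow> conv u (basis_elt f) = (basis_elt f :: 'a \<Rightarrow> 'k)"
      by auto
    \<comment> \<open>Formally \<open>1 - w = (1 - e)(1 - u)\<close>, so \<open>w\<close> fixes
      whatever \<open>e\<close> or \<open>u\<close> fixes.\<close>
    let ?w = "basis_elt e + u - conv (basis_elt e) u"
    have e: "e \<in> E" using insert by auto
    have "conv ?w (basis_elt e) = basis_elt e"
      using comm[OF u(1) basis[OF e]] E_idem[OF e]
      by (simp add: conv_add_left diff conv_assoc conv_basis_elt flip: conv_assoc[of "basis_elt e" "basis_elt e"])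
    moreover have "conv ?w (basis_elt f) = basis_elt f" if "f \<in> F" for f
      using u(2)[OF that] by (simp add: conv_add_left diff conv_assoc)
    moreover have "?w \<in> fin_supp_on E" using u(1) basis[OF e] closed fin_supp_on_closed by blast
    ultimately show ?case by blast
  qed
  from this[OF finite subset_refl] obtain u where u: "u \<in> fin_supp_on E"
      "\<And>e. e \<in> E \<Longrightarrow> conv u (basis_elt e) = (basis_elt e :: 'a \<Rightarrow> 'k)"
    by metis
  have left: "conv u (basis_elt s) = basis_elt s" for s
    using conv_assoc[of u "basis_elt s\<^sup>\<oplus>" "basis_elt s"] u(2)[OF proj_in_E(1)]
    by (simp add: conv_basis_elt plus_proj_mult)
  have "conv (basis_elt e) u = basis_elt e" if "e \<in> E" for e
    using comm[OF u(1) basis[OF that]] u(2)[OF that] by simp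
  then have right: "conv (basis_elt s) u = basis_elt s" for s
    using conv_assoc[of "basis_elt s" "basis_elt s\<^sup>\<star>" u] proj_in_E(2)[of s]
    by (simp add: conv_basis_elt mult_star_proj)
  have expand: "(\<Sum>s\<in>UNIV. f s * basis_elt s x) = f x" for f :: "'a \<Rightarrow> 'k" and x
    by (simp add: basis_elt_def if_distrib cong: if_cong)
  have "conv u f x = f x" "conv f u x = f x" for f x
    using conv_expand_right[of u f x] conv_expand_left[of f u x] expand[of f x]
    by (simp_all add: left right)
  then have "conv u f = f \<and> conv f u = f" for f by (simp add: fun_eq_iff)
  then show ?thesis using u(1) by blast
qed

text \<open>An element \<open>t\<close> with domain and range both \<open>e\<close> is invertible by
  EI, and its coefficient in \<open>e n e\<close> is then exactly \<open>iso_coeff n t\<close>,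
  which vanishes. Every surviving term therefore drops strictly below \<open>e\<close> on at least
  one side.\<close>

lemma local_coeff_zero:
  fixes n :: "'a \<Rightarrow> 'k::field"
  assumes e: "e \<in> E" and n: "iso_coeff n = 0"
  defines "w \<equiv> conv (conv (basis_elt e) n) (basis_elt e)"
  assumes "w t \<noteq> 0"
  shows "e * t\<^sup>\<oplus> = t\<^sup>\<oplus>" "e * t\<^sup>\<star> = t\<^sup>\<star>" "t\<^sup>\<oplus> \<noteq> e \<or> t\<^sup>\<star> \<noteq> e"
proof -
  have "w t = (\<Sum>s\<in>UNIV. n s * basis_elt (e * s * e) t)"
  proof -
    have "w t = (\<Sum>s\<in>UNIV. conv (basis_elt e) n s * basis_elt (s * e) t)"
      unfolding w_def conv_expand_left[of "conv (basis_elt e) n"] by (simp add: conv_basis_elt)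
    also have "\<dots> = (\<Sum>s\<in>UNIV. (\<Sum>r\<in>UNIV. n r * basis_elt (e * r) s) * basis_elt (s * e) t)"
      using conv_expand_right[of "basis_elt e" n] by (simp add: conv_basis_elt)
    also have "\<dots> = (\<Sum>r\<in>UNIV. \<Sum>s\<in>UNIV. n r * basis_elt (e * r) s * basis_elt (s * e) t)"
      by (subst sum.swap) (simp add: sum_distrib_right)
    also have "\<dots> = (\<Sum>r\<in>UNIV. n r * basis_elt (e * r * e) t)"
    proof (intro sum.cong refl)
      fix r
      have "(\<Sum>s\<in>UNIV. n r * basis_elt (e * r) s * basis_elt (s * e) t) =
          (\<Sum>s\<in>UNIV. if s = e * r then n r * basis_elt (e * r * e) t else 0)"
        by (intro sum.cong refl) (auto simp: basis_elt_def[of "e * r"])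
      then show "(\<Sum>s\<in>UNIV. n r * basis_elt (e * r) s * basis_elt (s * e) t) = n r * basis_elt (e * r * e) t"
        by simp
    qed
    finally show ?thesis .
  qed
  also have "\<dots> = (\<Sum>s | e * s * e = t. n s)"
    by (rule sum.mono_neutral_cong_right) (auto simp: basis_elt_def)
  finally have w: "w t = (\<Sum>s | e * s * e = t. n s)" .
  then obtain s where "e * s * e = t" using \<open>w t \<noteq> 0\<close> by (metis (mono_tags, lifting) empty_Collect_eq sum.empty)
  then have t: "e * t = t" "t * e = t" using E_idem[OF e] by (auto simp: mult.assoc) (simp flip: mult.assoc)
  then show "e * t\<^sup>\<oplus> = t\<^sup>\<oplus>" "e * t\<^sup>\<star> = t\<^sup>\<star>"
    using plus_proj_absorb[OF e] star_proj_absorb[OF e] E_commute[OF e proj_in_E(2)] by auto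
  show "t\<^sup>\<oplus> \<noteq> e \<or> t\<^sup>\<star> \<noteq> e"
  proof (rule ccontr)
    assume "\<not> ?thesis"
    then have te: "t\<^sup>\<oplus> = e" "t\<^sup>\<star> = e" by auto
    then have "iso_coeff n t = w t" using EI[of t] unfolding w iso_coeff_def by simp
    then show False using n \<open>w t \<noteq> 0\<close> by simp
  qed
qed

lemma ring_algebra: "ring (semigroup_algebra UNIV :: ('k::field, 'a \<Rightarrow> 'k) module)"
  using unit_exists ring_semigroup_algebra by metis

text \<open>Left ideals are those of the ring; closure under scalars holds because
  \<open>c x\<close> is the product of \<open>c u\<close> and \<open>x\<close> for the identity
  \<open>u\<close>.\<close>

lemma left_ideal_fun:
  fixes I :: "('a \<Rightarrow> 'k::field) set"
  assumes I: "left_ideal I (semigroup_algebra UNIV)"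
  shows "0 \<in> I" "x \<in> I \<Longrightarrow> y \<in> I \<Longrightarrow> x + y \<in> I" "x \<in> I \<Longrightarrow> conv z x \<in> I"
    "x \<in> I \<Longrightarrow> (\<lambda>s. c * x s) \<in> I"
proof -
  show "0 \<in> I" "x \<in> I \<Longrightarrow> y \<in> I \<Longrightarrow> x + y \<in> I"
    using left_idealD[OF I] by auto
  show conv: "x \<in> I \<Longrightarrow> conv z x \<in> I" for x z
    using left_idealD(4)[OF I] by (auto simp: fin_supp_on_finite)
  obtain u where "\<And>f. conv u f = (f :: 'a \<Rightarrow> 'k)" using unit_exists by metis
  then have "(\<lambda>s. c * x s) = conv (\<lambda>s. c * u s) x" by (simp add: conv_smult_left)
  then show "x \<in> I \<Longrightarrow> (\<lambda>s. c * x s) \<in> I" using conv by simp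
qed

lemma left_ideal_sum:
  fixes I :: "('a \<Rightarrow> 'k::field) set"
  assumes I: "left_ideal I (semigroup_algebra UNIV)"
  shows "(\<And>j. j \<in> J \<Longrightarrow> x j \<in> I) \<Longrightarrow> (\<Sum>j\<in>J. x j) \<in> I"
proof (induction J rule: infinite_finite_induct)
  case (insert j J)
  have "x j + sum x J \<in> I" using insert by (intro left_ideal_fun(2)[OF I]) auto
  then show ?case by (subst sum.insert[OF insert.hyps])
qed (use left_ideal_fun(1)[OF I] in \<open>simp_all only: sum.infinite sum.empty not_False_eq_True\<close>)

text \<open>Each term \<open>t\<close> of \<open>e n e\<close> has a projection strictly below
  \<open>e\<close>. If it is the domain, write \<open>t\<close> as domain times \<open>t\<close>. If
  it is the range, it sends \<open>y\<close> into \<open>I\<close> first and \<open>t\<close> keeps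
  the result there.\<close>

lemma kernel_local_mem:
  fixes I :: "('a \<Rightarrow> 'k::field) set"
  assumes I: "left_ideal I (semigroup_algebra UNIV)"
    and e: "e \<in> E" and below: "\<And>f y. f \<in> E \<Longrightarrow> e * f = f \<Longrightarrow> f \<noteq> e \<Longrightarrow> conv (basis_elt f) y \<in> I"
    and n: "iso_coeff n = 0"
  shows "conv (basis_elt e) (conv n (conv (basis_elt e) y)) \<in> I"
proof -
  define w where "w = conv (conv (basis_elt e) n) (basis_elt e)"
  have "(\<lambda>x. w t * conv (basis_elt t) y x) \<in> I" for t
  proof (cases "w t = 0")
    case True
    then have "(\<lambda>x. w t * conv (basis_elt t) y x) = 0" by (simp add: fun_eq_iff)
    then show ?thesis using left_ideal_fun(1)[OF I] by simp
  next
    case False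
    note t = local_coeff_zero[OF e n False[unfolded w_def]]
    have "conv (basis_elt t) y \<in> I"
    proof (cases "t\<^sup>\<oplus> = e")
      case False
      then have "conv (basis_elt t\<^sup>\<oplus>) (conv (basis_elt t) y) \<in> I" using below t proj_in_E by blast
      then show ?thesis by (simp add: conv_basis_elt plus_proj_mult flip: conv_assoc)
    next
      case True
      then have "conv (basis_elt t\<^sup>\<star>) y \<in> I" using below t proj_in_E by blast
      then have "conv (basis_elt t) (conv (basis_elt t\<^sup>\<star>) y) \<in> I" using left_ideal_fun(3)[OF I] by blast
      then show ?thesis by (simp add: conv_basis_elt mult_star_proj flip: conv_assoc)
    qed
    then show ?thesis by (rule left_ideal_fun(4)[OF I])
  qed
  then have "(\<Sum>t\<in>UNIV. (\<lambda>x. w t * conv (basis_elt t) y x)) \<in> I" by (rule left_ideal_sum[OF I])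
  also have "(\<Sum>t\<in>UNIV. (\<lambda>x. w t * conv (basis_elt t) y x)) = conv w y"
    using conv_expand_left[of w y] by (simp add: fun_eq_iff sum_fun_apply)
  finally show ?thesis by (simp add: w_def conv_assoc)
qed

text \<open>
  In the simple module \<open>KS/I\<close> choose \<open>e\<close> minimal among the elements of \<open>E\<close> acting nontrivially.
  Then \<open>e n e\<close> acts as zero for \<open>n\<close> in the kernel, since only endomorphisms of \<open>e\<close> contribute, and
  simplicity forces \<open>n\<close> to act as zero.
\<close>

lemma kernel_subset_maximal_left_ideal:
  fixes I :: "('a \<Rightarrow> 'k::field) set"
  assumes max: "maximal_left_ideal I (semigroup_algebra UNIV)" and n: "iso_coeff n = 0"
  shows "n \<in> I"
proof (rule ccontr)
  assume "n \<notin> I"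
  interpret ring "semigroup_algebra UNIV :: ('k, 'a \<Rightarrow> 'k) module" by (rule ring_algebra)
  have I: "left_ideal I (semigroup_algebra UNIV)" using max unfolding maximal_left_ideal_def by blast
  note I_closed = left_ideal_fun[OF I]
  have UNIV: "J = I \<or> J = UNIV" if "left_ideal J (semigroup_algebra UNIV)" "I \<subseteq> J" for J
    using max that unfolding maximal_left_ideal_def by (auto simp: fin_supp_on_finite)
  obtain u :: "'a \<Rightarrow> 'k" where u: "u \<in> fin_supp_on E" "\<And>f. conv u f = f" "\<And>f. conv f u = f"
    using unit_exists by metis
  have "u \<notin> I"
    using max I_closed(3)[of u] u(3) unfolding maximal_left_ideal_def by (auto simp: fin_supp_on_finite)
  let ?P = "\<lambda>e. e \<in> E \<and> (\<exists>y. conv (basis_elt e) y \<notin> I)"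
  have "\<exists>e. ?P e"
  proof (rule ccontr)
    assume "\<nexists>e. ?P e"
    then have "(\<lambda>x. u s * conv (basis_elt s) u x) \<in> I" for s
      using u(1) I_closed(1) I_closed(4) by (cases "s \<in> E") (auto simp: fin_supp_on_finite zero_fun_def)
    then have "(\<Sum>s\<in>UNIV. (\<lambda>x. u s * conv (basis_elt s) u x)) \<in> I" by (rule left_ideal_sum[OF I])
    also have "(\<Sum>s\<in>UNIV. (\<lambda>x. u s * conv (basis_elt s) u x)) = conv u u"
      using conv_expand_left[of u u] by (simp add: fun_eq_iff sum_fun_apply)
    finally show False using \<open>u \<notin> I\<close> u by simp
  qed
  then obtain e y where e: "e \<in> E" and y: "conv (basis_elt e) y \<notin> I"
    and min: "\<And>f. ?P f \<Longrightarrow> proj_rank e \<le> proj_rank f"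
    using ex_has_least_nat[of ?P _ proj_rank] by metis
  have below: "conv (basis_elt f) y \<in> I" if f: "f \<in> E" "e * f = f" "f \<noteq> e" for f y
  proof (rule ccontr)
    assume "conv (basis_elt f) y \<notin> I"
    then have "proj_rank e \<le> proj_rank f" using min f(1) by blast
    moreover have "proj_rank f < proj_rank e"
      using f e by (intro proj_rank_less) (simp_all add: plus_proj_idem)
    ultimately show False by simp
  qed
  \<comment> \<open>The largest set that the kernel followed by \<open>e\<close> sends into
    \<open>I\<close>. It contains \<open>I\<close> and also the product of \<open>e\<close> and
    \<open>y\<close>, which is outside \<open>I\<close>. So it is everything, and taking
    \<open>z = u\<close> shows that \<open>e\<close> sends the whole kernel into
    \<open>I\<close>.\<close>
  define J where "J = {z. \<forall>m. iso_coeff m = 0 \<longrightarrow> conv (basis_elt e) (conv m z) \<in> I}"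
  have "left_ideal J (semigroup_algebra UNIV)"
  proof (rule left_idealI)
    show "r \<otimes>\<^bsub>semigroup_algebra UNIV\<^esub> a \<in> J" if "a \<in> J" for r a
    proof -
      have "conv (basis_elt e) (conv m (conv r a)) \<in> I" if "iso_coeff m = 0" for m
        using \<open>a \<in> J\<close> iso_coeff_conv_eq_zero(1)[OF that, of r] unfolding J_def
        by (simp flip: conv_assoc[of m r a])
      then show ?thesis by (simp add: J_def)
    qed
    show "a \<oplus>\<^bsub>semigroup_algebra UNIV\<^esub> b \<in> J" if "a \<in> J" "b \<in> J" for a b
      using that I_closed(2) by (simp add: J_def conv_add_right)
    show "\<zero>\<^bsub>semigroup_algebra UNIV\<^esub> \<in> J"
      using I_closed(1) by (simp add: J_def conv_zero_right)
  qed (auto simp: fin_supp_on_finite)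
  moreover have "I \<subseteq> J" unfolding J_def using I_closed(3) by blast
  moreover have "conv (basis_elt e) y \<in> J"
    unfolding J_def using kernel_local_mem[OF I e below] by blast
  ultimately have "u \<in> J" using UNIV y by blast
  then have eN: "conv (basis_elt e) m \<in> I" if "iso_coeff m = 0" for m
    using that u unfolding J_def by simp
  \<comment> \<open>The kernel plus \<open>I\<close>. It contains \<open>n\<close>, so by maximality
    it is everything; but \<open>e\<close> sends both summands into \<open>I\<close>, against the
    choice of \<open>y\<close>.\<close>
  define M where "M = {m + i | m i. iso_coeff m = 0 \<and> i \<in> I}"
  have "left_ideal M (semigroup_algebra UNIV)"
  proof (rule left_idealI)
    show "r \<otimes>\<^bsub>semigroup_algebra UNIV\<^esub> a \<in> M" if "a \<in> M" for r a
    proof -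
      obtain m i where "a = m + i" "iso_coeff m = 0" "i \<in> I" using \<open>a \<in> M\<close> unfolding M_def by blast
      then have "conv r a = conv r m + conv r i" "iso_coeff (conv r m) = 0" "conv r i \<in> I"
        using iso_coeff_conv_eq_zero(2) I_closed(3) conv_add_right by blast+
      then show ?thesis unfolding M_def by auto
    qed
    show "a \<oplus>\<^bsub>semigroup_algebra UNIV\<^esub> b \<in> M" if "a \<in> M" "b \<in> M" for a b
    proof -
      obtain m i where a: "a = m + i" "iso_coeff m = 0" "i \<in> I" using \<open>a \<in> M\<close> unfolding M_def by blast
      obtain m' i' where b: "b = m' + i'" "iso_coeff m' = 0" "i' \<in> I" using \<open>b \<in> M\<close> unfolding M_def by blast
      have "a + b = (m + m') + (i + i')" using a b by (simp add: add_ac)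
      moreover have "iso_coeff (m + m') = 0" using a b by (simp add: iso_coeff_add)
      moreover have "i + i' \<in> I" using a b I_closed(2) by blast
      ultimately show ?thesis unfolding M_def by auto
    qed
    have "0 = 0 + (0 :: 'a \<Rightarrow> 'k)" by simp
    then show "\<zero>\<^bsub>semigroup_algebra UNIV\<^esub> \<in> M"
      unfolding M_def semigroup_algebra_simps using I_closed(1) iso_coeff_zero by blast
  qed (auto simp: fin_supp_on_finite)
  moreover have IM: "I \<subseteq> M"
  proof
    fix i assume "i \<in> I"
    moreover have "i = 0 + i" by simp
    ultimately show "i \<in> M" unfolding M_def using iso_coeff_zero by blast
  qed
  moreover have "n \<in> M"
  proof -
    have "n = n + 0" by simp
    then show ?thesis unfolding M_def using n I_closed(1) by blast
  qed
  ultimately have "y \<in> M" using UNIV \<open>n \<notin> I\<close> by blast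
  then obtain m i where "y = m + i" "iso_coeff m = 0" "i \<in> I" unfolding M_def by blast
  then have "conv (basis_elt e) y \<in> I"
    using eN I_closed(2,3) conv_add_right[of "basis_elt e" m i] by metis
  then show False using y by blast
qed

lemma kernel_subset_radical:
  "{x :: 'a \<Rightarrow> 'k::field. iso_coeff x = 0} \<subseteq> jacobson_radical (semigroup_algebra UNIV)"
  using kernel_subset_maximal_left_ideal unfolding jacobson_radical_def
  by (auto simp: fin_supp_on_finite)

section \<open>Endomorphism groups and semisimplicity\<close>

lemma End_monoid_simps:
  "carrier (End_monoid (Ehresmann_category E) e) = {a. a\<^sup>\<oplus> = e \<and> a\<^sup>\<star> = e}"
  "mult (End_monoid (Ehresmann_category E) e) = (*)"
  "one (End_monoid (Ehresmann_category E) e) = e"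
  by (auto simp: End_monoid_def Hom_def Ehresmann_category_def)

lemma group_End_monoid:
  assumes "e \<in> E"
  shows "group (End_monoid (Ehresmann_category E) e)"
proof (rule groupI, unfold End_monoid_simps)
  fix a assume "a \<in> {a. a\<^sup>\<oplus> = e \<and> a\<^sup>\<star> = e}"
  then show "\<exists>b\<in>{a. a\<^sup>\<oplus> = e \<and> a\<^sup>\<star> = e}. b * a = e"
    using EI[of a] unfolding Reg_iff inverse_arrows_def by auto
qed (use assms plus_proj_mult in \<open>auto simp: plus_proj_comp star_proj_comp plus_proj_idem star_proj_idem mult.assoc\<close>)

lemma inverse_arrows_End:
  assumes e: "e \<in> E" and a: "a \<in> carrier (End_monoid (Ehresmann_category E) e)"
  shows "inverse_arrows a (inv\<^bsub>End_monoid (Ehresmann_category E) e\<^esub> a)"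
proof -
  interpret group "End_monoid (Ehresmann_category E) e" by (rule group_End_monoid[OF e])
  show ?thesis
    using r_inv[OF a] l_inv[OF a] inv_closed[OF a] a by (simp add: End_monoid_simps inverse_arrows_def)
qed

text \<open>
  Otherwise the image of the radical in the group algebra of some endomorphism group is a nonzero
  left ideal, so it contains an element \<open>\<epsilon>\<close> as in Maschke's argument. It lifts to an element \<open>x\<close> of
  the radical such that \<open>1 - x\<close> annihilates a lift of \<open>\<epsilon>\<close> modulo the kernel, although \<open>1 - x\<close> is left
  invertible.
\<close>

lemma radical_subset_kernel:
  fixes r :: "'a \<Rightarrow> 'k::field"
  assumes char: "\<And>e. e \<in> E \<Longrightarrow> of_nat (order (End_monoid (Ehresmann_category E) e)) \<noteq> (0::'k)"
    and r: "r \<in> jacobson_radical (semigroup_algebra UNIV)"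
  shows "iso_coeff r = 0"
proof (rule ccontr)
  let ?Rad = "jacobson_radical (semigroup_algebra UNIV) :: ('a \<Rightarrow> 'k) set"
  assume "iso_coeff r \<noteq> 0"
  then obtain b where b: "iso_coeff r b \<noteq> 0" by (auto simp: fun_eq_iff)
  then have "b \<in> Reg E" unfolding iso_coeff_def by (auto split: if_splits)
  then obtain b' where b': "inverse_arrows b' b" using Reg_iff inverse_arrows_sym by blast
  interpret ring "semigroup_algebra UNIV :: ('k, 'a \<Rightarrow> 'k) module" by (rule ring_algebra)
  note Rad = left_ideal_fun[OF left_ideal_jacobson_radical]
  have lift: "\<exists>x. iso_coeff x = (basis_elt a :: 'a \<Rightarrow> 'k)" if "a \<in> Reg E" for a
    using iso_coeff_surj_basis[OF that] by blast
  \<comment> \<open>A lift of the inverse \<open>b'\<close> of \<open>b\<close> moves the nonzero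
    coefficient at \<open>b\<close> to the identity arrow \<open>f\<close>, so the radical is
    visible in the group at \<open>f\<close>.\<close>
  define f where "f = b\<^sup>\<star>"
  have f: "f \<in> E" "f \<in> Reg E" "f\<^sup>\<oplus> = f" "f\<^sup>\<star> = f" "inverse_arrows f f"
    using proj_in_E(2)[of b] E_subset_Reg plus_proj_idem star_proj_idem E_idem
    by (auto simp: f_def inverse_arrows_def)
  define G where "G = End_monoid (Ehresmann_category E) f"
  interpret G: group G unfolding G_def by (rule group_End_monoid[OF f(1)])
  have G: "a \<in> carrier G \<longleftrightarrow> a\<^sup>\<oplus> = f \<and> a\<^sup>\<star> = f" "a \<otimes>\<^bsub>G\<^esub> c = a * c" for a c
    by (auto simp: G_def End_monoid_simps)
  have G_Reg: "a \<in> Reg E" if "a \<in> carrier G" for a using that G(1) EI by simp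
  have G_inv: "inverse_arrows a (inv\<^bsub>G\<^esub> a)" if "a \<in> carrier G" for a
    using inverse_arrows_End[OF f(1)] that unfolding G_def by blast
  define res :: "('a \<Rightarrow> 'k) \<Rightarrow> 'a \<Rightarrow> 'k" where "res x a = (if a \<in> carrier G then iso_coeff x a else 0)" for x a
  have "\<exists>\<epsilon>\<in>res ` ?Rad. \<forall>v\<in>res ` ?Rad. \<forall>a\<in>carrier G.
      (\<Sum>c\<in>carrier G. v c * \<epsilon> (inv\<^bsub>G\<^esub> c \<otimes>\<^bsub>G\<^esub> a)) = v a"
  proof (rule Maschke_right_identity[OF G.group_axioms])
    show "of_nat (order G) \<noteq> (0::'k)" unfolding G_def by (rule char[OF f(1)])
    have "res 0 = 0" by (simp add: fun_eq_iff res_def iso_coeff_zero)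
    then show "0 \<in> res ` ?Rad" using Rad(1) by (metis imageI)
    show "v + w \<in> res ` ?Rad" if vw: "v \<in> res ` ?Rad" "w \<in> res ` ?Rad" for v w
    proof -
      obtain x y where xy: "x \<in> ?Rad" "y \<in> ?Rad" "v = res x" "w = res y" using vw by blast
      have "v + w = res (x + y)" unfolding xy by (simp add: fun_eq_iff res_def iso_coeff_add)
      then show ?thesis using Rad(2) xy by blast
    qed
    show "(\<lambda>a. c * v a) \<in> res ` ?Rad" if v: "v \<in> res ` ?Rad" for c v
    proof -
      obtain x where x: "x \<in> ?Rad" "v = res x" using v by blast
      have "(\<lambda>a. c * v a) = res (\<lambda>s. c * x s)" unfolding x by (simp add: fun_eq_iff res_def iso_coeff_smult)
      then show ?thesis using Rad(4) x by blast
    qed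
    show "(\<lambda>a. if a \<in> carrier G then v (g \<otimes>\<^bsub>G\<^esub> a) else 0) \<in> res ` ?Rad"
      if g: "g \<in> carrier G" and v: "v \<in> res ` ?Rad" for g v
    proof -
      obtain x where x: "x \<in> ?Rad" "v = res x" using v by blast
      \<comment> \<open>Translation by \<open>g\<close> is left multiplication by a lift of its
        inverse, under which the radical is stable.\<close>
      obtain y where y: "iso_coeff y = (basis_elt (inv\<^bsub>G\<^esub> g) :: 'a \<Rightarrow> 'k)"
        using lift[OF G_Reg[OF G.inv_closed[OF g]]] by blast
      have "(\<lambda>a. if a \<in> carrier G then v (g \<otimes>\<^bsub>G\<^esub> a) else 0) = res (conv y x)"
      proof
        fix a
        show "(if a \<in> carrier G then v (g \<otimes>\<^bsub>G\<^esub> a) else 0) = res (conv y x) a"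
        proof (cases "a \<in> carrier G")
          case True
          have "(inv\<^bsub>G\<^esub> g)\<^sup>\<oplus> = a\<^sup>\<oplus>" using G(1) G.inv_closed[OF g] True by simp
          then have "iso_coeff (conv y x) a = iso_coeff x (g * a)"
            using iso_coeff_conv_basis_left[OF inverse_arrows_sym[OF G_inv[OF g]] y G_Reg[OF True]] by simp
          moreover have "g * a \<in> carrier G" using G.m_closed[OF g True] unfolding G(2) .
          ultimately show ?thesis using True unfolding x by (simp add: res_def G(2))
        qed (simp add: res_def)
      qed
      then show ?thesis using Rad(3)[OF x(1)] by blast
    qed
  qed (auto simp: res_def)
  then obtain y where y: "y \<in> ?Rad"
    and right_id: "\<And>x a. x \<in> ?Rad \<Longrightarrow> a \<in> carrier G \<Longrightarrow>
      (\<Sum>c\<in>carrier G. res x c * res y (inv\<^bsub>G\<^esub> c * a)) = res x a"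
    unfolding G(2) by blast
  obtain bh where bh: "iso_coeff bh = (basis_elt b' :: 'a \<Rightarrow> 'k)" using lift b' Reg_iff by blast
  have "b'\<^sup>\<oplus> = f" "b * f = b" using b' mult_star_proj[of b] by (auto simp: inverse_arrows_def f_def)
  then have "iso_coeff (conv bh r) f = iso_coeff r b"
    using iso_coeff_conv_basis_left[OF b' bh f(2), of r] f(3) by simp
  moreover have fG: "f \<in> carrier G" using G(1) f by simp
  ultimately have "res (conv bh r) f \<noteq> 0" using b by (simp add: res_def)
  then have "res y \<noteq> 0" using right_id[OF Rad(3)[OF r] fG, of bh] by auto
  have "res y \<in> fin_supp_on (Reg E)" using G_Reg by (auto simp: fin_supp_on_finite res_def)
  then obtain z where z: "iso_coeff z = res y" using iso_coeff_surj by blast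
  obtain fh where fh: "iso_coeff fh = (basis_elt f :: 'a \<Rightarrow> 'k)" using lift f by blast
  \<comment> \<open>\<open>y\<close> may have coefficients at arrows with other domains. Multiplying
    by a lift of \<open>f\<close> removes them, while \<open>z\<close> ends the product at
    \<open>f\<close>. Hence the product of \<open>x\<close> and \<open>z\<close> sees only the group
    part of \<open>y\<close>, and its image is the square of \<open>res y\<close>.\<close>
  define x where "x = conv fh y"
  have x: "iso_coeff x c = (if c\<^sup>\<oplus> = f then iso_coeff y c else 0)" if "c \<in> Reg E" for c
    using iso_coeff_conv_basis_left[OF f(5) fh that, of y] f(3) plus_proj_mult[of c] by (auto simp: x_def)
  have "iso_coeff (conv x z) a = res y a" for a
  proof (cases "a \<in> Reg E")
    case True
    have expand: "iso_coeff (conv x z) a = (\<Sum>(c, d)\<in>factorizations a. iso_coeff x c * res y d)"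
      unfolding iso_coeff_conv[OF True] z ..
    show ?thesis
    proof (cases "a \<in> carrier G")
      case aG: True
      \<comment> \<open>The factorizations starting in the group are the pairs
        \<open>(c, c^-1 a)\<close>, which index the group convolution in
        \<open>right_id\<close>.\<close>
      have eq: "{p \<in> factorizations a. fst p \<in> carrier G} = (\<lambda>c. (c, inv\<^bsub>G\<^esub> c * a)) ` carrier G"
      proof (intro equalityI subsetI)
        fix p assume "p \<in> {p \<in> factorizations a. fst p \<in> carrier G}"
        then obtain c d where p: "p = (c, d)" "(c, d) \<in> factorizations a" "c \<in> carrier G" by (cases p) auto
        have "inv\<^bsub>G\<^esub> c * a = inv\<^bsub>G\<^esub> c * c * d" using p(2) by (auto simp: factorizations_def mult.assoc)
        also have "inv\<^bsub>G\<^esub> c * c = d\<^sup>\<oplus>"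
          using G_inv[OF p(3)] factorizations_proj(3)[OF p(2)] by (simp add: inverse_arrows_def)
        finally have "inv\<^bsub>G\<^esub> c * a = d" by (simp add: plus_proj_mult)
        then show "p \<in> (\<lambda>c. (c, inv\<^bsub>G\<^esub> c * a)) ` carrier G" using p by blast
      next
        fix p assume "p \<in> (\<lambda>c. (c, inv\<^bsub>G\<^esub> c * a)) ` carrier G"
        then obtain c where p: "p = (c, inv\<^bsub>G\<^esub> c * a)" and c: "c \<in> carrier G" by blast
        have d: "inv\<^bsub>G\<^esub> c * a \<in> carrier G" using G.m_closed[OF G.inv_closed[OF c] aG] unfolding G(2) .
        have "c * (inv\<^bsub>G\<^esub> c * a) = a"
          using G.m_assoc[OF c G.inv_closed[OF c] aG] G.r_inv[OF c] G.l_one[OF aG] unfolding G(2) by simp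
        then show "p \<in> {p \<in> factorizations a. fst p \<in> carrier G}"
          unfolding p factorizations_def using c d G_Reg G(1) by simp
      qed
      have outside: "res y d = 0" if "(c, d) \<in> factorizations a" "c \<notin> carrier G" for c d
        using that factorizations_proj[OF that(1)] aG G(1) by (simp add: res_def)
      have "iso_coeff (conv x z) a = (\<Sum>(c, d)\<in>{p \<in> factorizations a. fst p \<in> carrier G}. iso_coeff x c * res y d)"
        unfolding expand by (rule sum.mono_neutral_right) (auto, metis outside)
      also have "\<dots> = (\<Sum>c\<in>carrier G. iso_coeff x c * res y (inv\<^bsub>G\<^esub> c * a))"
        unfolding eq by (subst sum.reindex) (auto simp: inj_on_def)
      also have "\<dots> = (\<Sum>c\<in>carrier G. res y c * res y (inv\<^bsub>G\<^esub> c * a))"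
        by (intro sum.cong refl) (use x G_Reg G(1) in \<open>simp add: res_def\<close>)
      finally show ?thesis using right_id[OF y aG] by simp
    next
      case False
      have "iso_coeff x c * res y d = 0" if cd: "(c, d) \<in> factorizations a" for c d
      proof (rule ccontr)
        assume nz: "iso_coeff x c * res y d \<noteq> 0"
        have "c \<in> Reg E" using cd by (simp add: factorizations_def)
        then have "c\<^sup>\<oplus> = f" using nz x by (auto split: if_splits)
        moreover have "d\<^sup>\<star> = f" using nz G(1) by (auto simp: res_def split: if_splits)
        ultimately show False using False factorizations_proj[OF cd] G(1) by simp
      qed
      then have "iso_coeff (conv x z) a = 0" unfolding expand by (intro sum.neutral) auto
      then show ?thesis using False by (simp add: res_def)
    qed
  next
    case False
    then show ?thesis using G_Reg by (auto simp: res_def iso_coeff_def)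
  qed
  then have xz: "iso_coeff (conv x z) = iso_coeff z" using z by auto
  have xRad: "x \<in> ?Rad" unfolding x_def using Rad(3)[OF y] .
  obtain u :: "'a \<Rightarrow> 'k" where u: "\<And>f. conv u f = f" "\<And>f. conv f u = f" using unit_exists by metis
  have one: "\<one>\<^bsub>semigroup_algebra UNIV\<^esub> = u"
    using u by (intro one_semigroup_algebra) (auto simp: fin_supp_on_finite)
  define w where "w = \<one>\<^bsub>semigroup_algebra UNIV\<^esub> \<ominus>\<^bsub>semigroup_algebra UNIV\<^esub> x"
  have all: "v \<in> carrier (semigroup_algebra UNIV)" for v :: "'a \<Rightarrow> 'k" by (simp add: fin_supp_on_finite)
  have "w \<oplus>\<^bsub>semigroup_algebra UNIV\<^esub> x = \<one>\<^bsub>semigroup_algebra UNIV\<^esub>"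
    unfolding w_def minus_eq using all by (simp only: a_assoc a_inv_closed l_neg r_zero one_closed)
  then have "w + x = u" using one by simp
  then have "conv w z + conv x z = z" using u(1)[of z] conv_add_left[of w x z] by simp
  then have "iso_coeff (conv w z) + iso_coeff z = iso_coeff z" using xz iso_coeff_add by metis
  \<comment> \<open>With \<open>w = 1 - x\<close> and a left inverse \<open>t\<close> of
    \<open>w\<close>, the element \<open>z\<close> is \<open>t\<close> times a kernel element,
    although its image \<open>res y\<close> is nonzero.\<close>
  then have "iso_coeff (conv w z) = 0" by simp
  moreover obtain t where "conv t w = u"
    using jacobson_radical_left_inverse[OF xRad] one unfolding w_def by auto
  ultimately have "iso_coeff z = 0"
    using iso_coeff_conv_eq_zero(2)[of "conv w z" t] u(1) by (simp flip: conv_assoc)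
  then show False using z \<open>res y \<noteq> 0\<close> by simp
qed

end

section \<open>The quotient by the radical\<close>

lemma quotient_algebra_simps:
  "carrier (quotient_algebra A I) = a_rcosets\<^bsub>A\<^esub> I"
  "mult (quotient_algebra A I) = rcoset_mult A I"
  "one (quotient_algebra A I) = I +>\<^bsub>A\<^esub> \<one>\<^bsub>A\<^esub>"
  "add (quotient_algebra A I) = set_add A"
  "smult (quotient_algebra A I) = (\<lambda>c X. \<Union>x\<in>X. I +>\<^bsub>A\<^esub> (c \<odot>\<^bsub>A\<^esub> x))"
  by (simp_all add: quotient_algebra_def FactRing_def ring.defs module.defs)

lemma finite_EI_Ehresmann_semigroupI:
  fixes E :: "'a::{semigroup_mult, finite} set"
  assumes "Ehresmann_semigroup E" "EI_category (Ehresmann_category E)"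
  shows "finite_EI_Ehresmann_semigroup E"
proof -
  interpret Ehresmann_semigroup E by fact
  interpret C: EI_category "Ehresmann_category E" by fact
  show ?thesis
  proof
    fix a :: 'a assume a: "a\<^sup>\<oplus> = a\<^sup>\<star>"
    then have "isomorphism (Ehresmann_category E) a"
      by (intro C.endo_isomorphism[of _ "a\<^sup>\<oplus>"]) (simp add: Hom_def Ehresmann_category_def)
    then show "a \<in> Reg E"
      unfolding Reg_iff isomorphism_def inverse_arrows_def by (auto simp: Hom_def Ehresmann_category_def)
  qed
qed

theorem proposition5p17:
  fixes E :: "'a::{semigroup_mult, finite} set"
  assumes "Ehresmann_semigroup E"
    and "EI_category (Ehresmann_category E)"
    and "\<And>e. e \<in> Obj (Ehresmann_category E) \<Longrightarrow>
      of_nat (order (End_monoid (Ehresmann_category E) e)) dvd (1 :: 'k::field)"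
  shows "is_algebra_iso
    (semigroup_algebra (Reg E) :: ('k, 'a \<Rightarrow> 'k) module)
    (quotient_algebra (semigroup_algebra UNIV)
      (jacobson_radical (semigroup_algebra UNIV :: ('k, 'a \<Rightarrow> 'k) module)))"
proof -
  interpret finite_EI_Ehresmann_semigroup E by (rule finite_EI_Ehresmann_semigroupI[OF assms(1,2)])
  let ?A = "semigroup_algebra UNIV :: ('k, 'a \<Rightarrow> 'k) module"
  define I where "I = jacobson_radical ?A"
  have char: "of_nat (order (End_monoid (Ehresmann_category E) e)) \<noteq> (0::'k)" if "e \<in> E" for e
    using assms(3)[of e] that by (auto simp: Ehresmann_category_def)
  have I: "I = {x. iso_coeff x = 0}"
    using radical_subset_kernel[OF char] kernel_subset_radical unfolding I_def by blast
  interpret ring ?A by (rule ring_algebra)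
  have lI: "left_ideal I ?A" unfolding I_def by (rule left_ideal_jacobson_radical)
  interpret ideal I ?A
  proof (intro ideal.intro ideal_axioms.intro)
    show "additive_subgroup I ?A" using lI unfolding left_ideal_def by blast
    show "ring ?A" by (rule ring_algebra)
    show "x \<otimes>\<^bsub>?A\<^esub> a \<in> I" "a \<otimes>\<^bsub>?A\<^esub> x \<in> I" if "a \<in> I" for a x
      using that iso_coeff_conv_eq_zero unfolding I by simp_all
  qed
  have all: "v \<in> carrier ?A" for v by (simp add: fin_supp_on_finite)
  \<comment> \<open>Cosets are the fibres of \<open>iso_coeff\<close>, so injectivity and
    surjectivity on the span of \<open>Reg E\<close> become bijectivity of the quotient map.\<close>
  have coset: "I +>\<^bsub>?A\<^esub> x = {y. iso_coeff y = iso_coeff x}" for x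
  proof -
    have "y \<in> I +>\<^bsub>?A\<^esub> x \<longleftrightarrow> y - x \<in> I" for y
      unfolding a_r_coset_def' by (auto intro: bexI[of _ "y - x"])
    then show ?thesis unfolding I by (auto simp: iso_coeff_diff)
  qed
  obtain u :: "'a \<Rightarrow> 'k" where u: "u \<in> fin_supp_on E" "\<And>f. conv u f = f" "\<And>f. conv f u = f"
    using unit_exists by metis
  have one: "\<one>\<^bsub>semigroup_algebra T\<^esub> = u" if "E \<subseteq> T" for T
    using u that by (intro one_semigroup_algebra) (auto simp: fin_supp_on_finite)
  let ?h = "\<lambda>x. I +>\<^bsub>?A\<^esub> x"
  let ?B = "semigroup_algebra (Reg E) :: ('k, 'a \<Rightarrow> 'k) module"
  have "?h \<in> ring_iso ?B (quotient_algebra ?A I)"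
  proof (rule ring_iso_memI)
    show "?h x \<in> carrier (quotient_algebra ?A I)" for x
      unfolding quotient_algebra_simps by (rule a_rcosetsI[OF a_subset all])
    show "?h (x \<otimes>\<^bsub>?B\<^esub> y) = ?h x \<otimes>\<^bsub>quotient_algebra ?A I\<^esub> ?h y" for x y
      unfolding quotient_algebra_simps rcoset_mult_add[OF all all] by simp
    show "?h (x \<oplus>\<^bsub>?B\<^esub> y) = ?h x \<oplus>\<^bsub>quotient_algebra ?A I\<^esub> ?h y" for x y
      unfolding quotient_algebra_simps a_rcos_sum[OF all all] by simp
    show "?h \<one>\<^bsub>?B\<^esub> = \<one>\<^bsub>quotient_algebra ?A I\<^esub>"
      unfolding quotient_algebra_simps using one[OF E_subset_Reg] one[OF subset_UNIV] by simp
    show "bij_betw ?h (carrier ?B) (carrier (quotient_algebra ?A I))"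
    proof (rule bij_betw_imageI)
      show "inj_on ?h (carrier ?B)"
      proof (rule inj_onI)
        fix x y assume "x \<in> carrier ?B" "y \<in> carrier ?B" and eq: "?h x = ?h y"
        then have "x - y \<in> fin_supp_on (Reg E)" by (auto intro: fin_supp_on_closed)
        moreover have "iso_coeff (x - y) = 0" using eq unfolding coset by (auto simp: iso_coeff_diff)
        ultimately show "x = y" using iso_coeff_inj[of "x - y"] by simp
      qed
      show "?h ` carrier ?B = carrier (quotient_algebra ?A I)"
      proof (intro equalityI subsetI)
        fix X assume "X \<in> carrier (quotient_algebra ?A I)"
        then obtain a where a: "X = ?h a" unfolding quotient_algebra_simps A_RCOSETS_def' by blast
        obtain r where "r \<in> fin_supp_on (Reg E)" "iso_coeff r = iso_coeff a"
          using iso_coeff_surj[OF iso_coeff_mem, of a] by blast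
        then show "X \<in> ?h ` carrier ?B" unfolding a coset by (intro image_eqI[of _ _ r]) simp_all
      qed (use a_rcosetsI[OF a_subset all] in \<open>auto simp: quotient_algebra_simps\<close>)
    qed
  qed
  moreover have "?h (c \<odot>\<^bsub>?B\<^esub> x) = c \<odot>\<^bsub>quotient_algebra ?A I\<^esub> ?h x" for c x
  proof -
    \<comment> \<open>Scalar multiplication of a coset is a union over representatives. All of them
      contribute the same fibre, and \<open>x\<close> is one of them, so the union is that
      fibre.\<close>
    have "(\<Union>y\<in>{y. iso_coeff y = iso_coeff x}. {z. iso_coeff z = (\<lambda>b. c * iso_coeff y b)}) =
        {z. iso_coeff z = (\<lambda>b. c * iso_coeff x b)}" by auto
    then show ?thesis unfolding quotient_algebra_simps semigroup_algebra_simps coset iso_coeff_smult by simp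
  qed
  ultimately show ?thesis unfolding is_algebra_iso_def algebra_iso_def I_def by blast
qed

end
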